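(* Assume $C\succ 0$ and $A_1,\dots,A_m$ are linearly independent. Fix a linearly feasible $F\succ 0$, and for $t\ge 0$ let $$X(t):=\arg\min\Bigl\{\, t\,\mathrm{tr}(CX) - \ln\det X + \mathrm{tr}(F^{-1}X) \;:\; \mathcal{A}\,\mathrm{vec}(X)=b,\ X\succ 0\Bigr\}$$ (the central path). Then $X(0)=F$ and $X(t)$ is a solution of the second-ansatz dynamics $$\mathrm{vec}(\dot X(t)) = -\bigl(I - (X\otimes X)\mathcal{A}^T(\mathcal{A}(X\otimes X)\mathcal{A}^T)^{-1} \mathcal{A}\bigr)(X\otimes X)\,\mathrm{vec}(C)$$ with starting point $X(0)=F$. Consequently, the second-ansatz dynamics started from any linearly feasible $X(0)\succ 0$ converges to the optimum of the SDP $\min\{\mathrm{tr}(CX): \mathrm{tr}(A_\ell X)=b_\ell\ \forall \ell\in[m],\ X\succeq 0\}$, i.e. $\mathrm{tr}(CX(t))$ tends to the optimal value as $t\to\infty$.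
   Context: $C,A_1,\dots,A_m$ are symmetric $n\times n$ matrices and $b\in\mathbb{R}^m$. For an $n\times n$ matrix $M$, $\mathrm{vec}(M)\in\mathbb{R}^{n^2}$ is obtained by stacking the columns of $M$; $\otimes$ is the Kronecker product, with $\mathrm{vec}(ABC)=(C^T\otimes A)\mathrm{vec}(B)$. $\mathcal{A}$ is the $m\times n^2$ matrix whose $\ell$-th row is $\mathrm{vec}(A_\ell)^T$. A matrix $X$ is linearly feasible if $\mathcal{A}\,\mathrm{vec}(X)=b$. *)

theory Defs
  imports "HOL-Analysis.Analysis"
begin

text \<open>n x n real matrices are modelled as real^'n^'n (index type 'n finite, n = CARD('n)).
  Vectors in R^(n^2) are indexed by pairs ('n \<times> 'n); the pair (i,j) stands for
  row i, column j, so the column-stacking order is immaterial (only a relabelling).\<close>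

definition vecm :: "real^'n^'n \<Rightarrow> real^('n \<times> 'n)" where
  "vecm M = (\<chi> p. M $ fst p $ snd p)"

text \<open>Kronecker product with the convention vec(A B C) = (C^T kron A) vec(B):
  (P kron Q) at ((i,j),(k,l)) = P_{j l} * Q_{i k}.\<close>
definition kron :: "real^'n^'n \<Rightarrow> real^'n^'n \<Rightarrow> real^('n \<times> 'n)^('n \<times> 'n)" where
  "kron P Q = (\<chi> p. \<chi> q. P $ snd p $ snd q * Q $ fst p $ fst q)"

definition calA :: "('m::finite \<Rightarrow> real^'n^'n) \<Rightarrow> real^('n \<times> 'n)^'m" where
  "calA A = (\<chi> l. vecm (A l))"

definition symmetric_mat :: "real^'n^'n \<Rightarrow> bool" where
  "symmetric_mat X \<longleftrightarrow> transpose X = X"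

definition pos_def :: "real^'n^'n \<Rightarrow> bool" where
  "pos_def X \<longleftrightarrow> symmetric_mat X \<and> (\<forall>x. x \<noteq> 0 \<longrightarrow> x \<bullet> (X *v x) > 0)"

definition pos_semidef :: "real^'n^'n \<Rightarrow> bool" where
  "pos_semidef X \<longleftrightarrow> symmetric_mat X \<and> (\<forall>x. x \<bullet> (X *v x) \<ge> 0)"

definition lin_feasible :: "('m::finite \<Rightarrow> real^'n^'n) \<Rightarrow> real^'m \<Rightarrow> real^'n^'n \<Rightarrow> bool" where
  "lin_feasible A b X \<longleftrightarrow> calA A *v vecm X = b"

definition lin_indep_family :: "('m::finite \<Rightarrow> real^'n^'n) \<Rightarrow> bool" where
  "lin_indep_family A \<longleftrightarrow> (\<forall>c. (\<Sum>l\<in>UNIV. c l *\<^sub>R A l) = 0 \<longrightarrow> (\<forall>l. c l = 0))"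

definition cp_objective :: "real^'n^'n \<Rightarrow> real^'n^'n \<Rightarrow> real \<Rightarrow> real^'n^'n \<Rightarrow> real" where
  "cp_objective C F t X = t * trace (C ** X) - ln (det X) + trace (matrix_inv F ** X)"

definition cp_minimizer ::
  "('m::finite \<Rightarrow> real^'n^'n) \<Rightarrow> real^'m \<Rightarrow> real^'n^'n \<Rightarrow> real^'n^'n \<Rightarrow> real \<Rightarrow> real^'n^'n \<Rightarrow> bool" where
  "cp_minimizer A b C F t X \<longleftrightarrow>
     lin_feasible A b X \<and> pos_def X \<and>
     (\<forall>Y. lin_feasible A b Y \<and> pos_def Y \<longrightarrow> cp_objective C F t X \<le> cp_objective C F t Y)"

definition central_path ::
  "('m::finite \<Rightarrow> real^'n^'n) \<Rightarrow> real^'m \<Rightarrow> real^'n^'n \<Rightarrow> real^'n^'n \<Rightarrow> real \<Rightarrow> real^'n^'n" where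
  "central_path A b C F t = (THE X. cp_minimizer A b C F t X)"

definition ansatz2_rhs ::
  "('m::finite \<Rightarrow> real^'n^'n) \<Rightarrow> real^'n^'n \<Rightarrow> real^'n^'n \<Rightarrow> real^('n \<times> 'n)" where
  "ansatz2_rhs A C X =
     (let K = kron X X; AA = calA A
      in - ((mat 1 - K ** transpose AA ** matrix_inv (AA ** K ** transpose AA) ** AA) ** K
            *v vecm C))"

definition ansatz2_solution ::
  "('m::finite \<Rightarrow> real^'n^'n) \<Rightarrow> real^'n^'n \<Rightarrow> (real \<Rightarrow> real^'n^'n) \<Rightarrow> bool" where
  "ansatz2_solution A C Y \<longleftrightarrow>
     (\<forall>t\<ge>0. ((\<lambda>s. vecm (Y s)) has_vector_derivative ansatz2_rhs A C (Y t)) (at t within {0..}))"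

definition sdp_opt :: "('m::finite \<Rightarrow> real^'n^'n) \<Rightarrow> real^'m \<Rightarrow> real^'n^'n \<Rightarrow> real" where
  "sdp_opt A b C = Inf {trace (C ** X) | X. (\<forall>l. trace (A l ** X) = b $ l) \<and> pos_semidef X}"

end

theory Submission
  imports Defs
begin

text \<open>
  Let S = t C + F^{-1} and let L be the span of the A_l. By convexity of -ln det, X minimises the
  barrier problem iff X^{-1} - S is orthogonal to every symmetric M orthogonal to L. Both
  uniqueness and the compactness of sublevel sets come from one inequality,
  ln det Y - ln det X \<le> X^{-1} \<bullet> (Y - X), proved by simultaneous diagonalisation.

  Subtracting the optimality conditions at s and t and testing with D = X(s) - X(t) gives
  (X(s)^{-1} D X(t)^{-1}) \<bullet> D = -(s - t) C \<bullet> D; the left side dominates a multiple of |D|^2,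
  so the path is Lipschitz, and the same estimate applied to the difference quotient minus the
  second-ansatz vector field yields the derivative without the implicit function theorem.

  Conversely, along any solution Y of the dynamics, Y^{-1} - t C is constant modulo L while Y stays
  positive definite, so Y satisfies the optimality conditions for F = Y(0) and coincides with the
  central path; since that path stays inside the open cone, Y can never leave it. Testing the
  optimality conditions with Z - X(t) for feasible Z gives C \<bullet> X(t) \<le> C \<bullet> Z + O(1/t).
\<close>

section \<open>Matrix algebra with the Frobenius inner product\<close>

text \<open>The term tr(F^{-1} X) anchors the path: at t = 0 the slope is F^{-1}, so stationarity is
  solved by X = F. Every feasible positive definite matrix therefore starts its own central path,
  and all these paths obey the same vector field, because F enters the optimality conditions only as
  a constant that differentiation removes. This is why a solution can be compared with the path
  anchored at its own starting point.

  Two obstacles shape the rest. The lower bound on the inverses along the path has to be uniform for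
  s near t before any continuity of the path is known; it comes from the duality gap tested with F,
  which bounds the trace on bounded time intervals. And a solution of the dynamics is not assumed to
  stay positive definite or even symmetric, while outside the cone the inverse in the vector field
  may be a default value. The formula for the vector field is therefore split into a part valid at
  every matrix, which gives symmetry for all times, and a part valid only in the cone.\<close>

definition diag_mat :: "('n \<Rightarrow> real) \<Rightarrow> real^'n^'n" where
  "diag_mat d = (\<chi> i j. if i = j then d i else 0)"

lemma diag_mat_nth: "diag_mat d $ i $ j = (if i = j then d i else 0)"
  by (simp add: diag_mat_def)

lemma diag_mat_mult_vec: "(diag_mat d *v y) $ i = d i * y $ i"
  by (simp add: matrix_vector_mult_def diag_mat_nth if_distrib[of "\<lambda>x. x * _"] cong: if_cong)

lemma inner_diag_mat_vec: "y \<bullet> (diag_mat d *v y) = (\<Sum>i\<in>UNIV. d i * (y $ i)\<^sup>2)"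
  by (simp add: inner_vec_def diag_mat_mult_vec power2_eq_square algebra_simps)

lemma inner_diag_mat: "diag_mat d \<bullet> M = (\<Sum>i\<in>UNIV. d i * M $ i $ i)"
  by (simp add: inner_vec_def diag_mat_nth if_distrib[of "\<lambda>x. x * _"] cong: if_cong)

lemma det_diag_mat: "det (diag_mat d) = (\<Prod>i\<in>UNIV. d i)"
  by (subst det_diagonal) (auto simp: diag_mat_nth)

lemma diag_mat_mult: "diag_mat d ** diag_mat e = diag_mat (\<lambda>i. d i * e i)"
  by (simp add: vec_eq_iff matrix_matrix_mult_def diag_mat_nth if_distrib[of "\<lambda>x. x * _"] cong: if_cong)

lemma diag_mat_one: "diag_mat (\<lambda>_. 1) = mat 1"
  by (simp add: vec_eq_iff diag_mat_nth mat_def)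

lemma transpose_diag_mat [simp]: "transpose (diag_mat d) = diag_mat d"
  by (auto simp: vec_eq_iff transpose_def diag_mat_nth)

lemma inner_matrix_mult_right:
  fixes M N P :: "real^'n^'n"
  shows "(M ** N) \<bullet> P = M \<bullet> (P ** transpose N)"
proof -
  have "(M ** N) \<bullet> P = (\<Sum>i\<in>UNIV. \<Sum>j\<in>UNIV. \<Sum>k\<in>UNIV. M$i$k * N$k$j * P$i$j)"
    by (simp add: inner_vec_def matrix_matrix_mult_def sum_distrib_right)
  also have "\<dots> = (\<Sum>i\<in>UNIV. \<Sum>k\<in>UNIV. \<Sum>j\<in>UNIV. M$i$k * N$k$j * P$i$j)"
    by (intro sum.cong refl sum.swap)
  also have "\<dots> = M \<bullet> (P ** transpose N)"
    by (simp add: inner_vec_def matrix_matrix_mult_def transpose_def sum_distrib_left mult_ac)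
  finally show ?thesis .
qed

lemma inner_transpose_transpose:
  fixes M N :: "real^'n^'n"
  shows "transpose M \<bullet> transpose N = M \<bullet> N"
  by (simp add: inner_vec_def transpose_def) (rule sum.swap)

lemma inner_matrix_mult_left:
  fixes M N P :: "real^'n^'n"
  shows "(M ** N) \<bullet> P = N \<bullet> (transpose M ** P)"
proof -
  have "(M ** N) \<bullet> P = (transpose N ** transpose M) \<bullet> transpose P"
    by (simp only: inner_transpose_transpose flip: matrix_transpose_mul)
  also have "\<dots> = transpose N \<bullet> transpose (transpose M ** P)"
    by (simp only: inner_matrix_mult_right matrix_transpose_mul)
  finally show ?thesis by (simp only: inner_transpose_transpose)
qed

lemma trace_mult_eq_inner:
  fixes M N :: "real^'n^'n"
  shows "trace (M ** N) = transpose M \<bullet> N"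
  by (simp add: trace_def inner_vec_def matrix_matrix_mult_def transpose_def) (rule sum.swap)

lemma inner_mat_one: "mat 1 \<bullet> (M :: real^'n^'n) = trace M"
  using trace_mult_eq_inner[of "mat 1" M] by simp

lemma inner_congruence:
  fixes W D :: "real^'n^'n"
  shows "x \<bullet> ((W ** D ** transpose W) *v x) = (transpose W *v x) \<bullet> (D *v (transpose W *v x))"
  by (simp add: dot_lmul_matrix flip: matrix_vector_mul_assoc)

lemma inner_symmetric_mat:
  assumes "symmetric_mat M"
  shows "x \<bullet> (M *v y) = (M *v x) \<bullet> y"
proof -
  have "x v* M = M *v x"
    using assms transpose_matrix_vector[of M x] by (simp add: symmetric_mat_def)
  then show ?thesis using dot_lmul_matrix[of x M y] by simp
qed

lemma norm_matrix_vector_mult_le: "norm (M *v x) \<le> norm M * norm (x :: real^'n)"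
  for M :: "real^'n^'m"
proof -
  have "norm (M *v x) \<le> L2_set (\<lambda>i. norm (M $ i) * norm x) UNIV"
    unfolding norm_vec_def[of "M *v x"]
    by (intro L2_set_mono) (simp_all add: matrix_vector_mul_component Cauchy_Schwarz_ineq2)
  also have "\<dots> = norm M * norm x"
    by (simp add: norm_vec_def[of M] L2_set_left_distrib)
  finally show ?thesis .
qed

lemma norm_transpose: "norm (transpose M) = norm M" for M :: "real^'n^'n"
  by (simp add: norm_eq_sqrt_inner inner_transpose_transpose)

text \<open>Row \<open>i\<close> of M N is the transpose of N applied to row \<open>i\<close> of M,
  so the vector bound applies row by row.\<close>

lemma norm_matrix_mult_le: "norm (M ** N) \<le> norm M * norm N" for M N :: "real^'n^'n"
proof -
  have row: "(M ** N) $ i = transpose N *v (M $ i)" for i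
    by (simp add: vec_eq_iff matrix_matrix_mult_def vector_matrix_mult_def mult.commute)
  have "norm (M ** N) \<le> L2_set (\<lambda>i. norm (M $ i) * norm N) UNIV"
    unfolding norm_vec_def[of "M ** N"] row
  proof (intro L2_set_mono)
    show "norm (transpose N *v (M $ i)) \<le> norm (M $ i) * norm N" for i
      by (metis norm_matrix_vector_mult_le norm_transpose mult.commute)
  qed simp
  also have "\<dots> = norm M * norm N"
    by (simp add: norm_vec_def[of M] L2_set_left_distrib)
  finally show ?thesis .
qed

text \<open>Once the product is known to be bounded bilinear, the general rules for such maps supply
  distributivity and limits of products together.\<close>

lemma bounded_bilinear_matrix_mult: "bounded_bilinear ((**) :: real^'n^'n \<Rightarrow> _ \<Rightarrow> real^'n^'n)"
proof (rule bounded_bilinear.intro)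
  show "\<exists>K. \<forall>(a :: real^'n^'n) (b :: real^'n^'n). norm (a ** b) \<le> norm a * norm b * K"
    by (rule exI[of _ 1]) (simp add: norm_matrix_mult_le)
qed (simp_all add: vec_eq_iff matrix_matrix_mult_def sum.distrib sum_distrib_left
       distrib_left distrib_right mult.left_commute mult.assoc)

lemmas matrix_mult_simps =
  bounded_bilinear.add_left[OF bounded_bilinear_matrix_mult]
  bounded_bilinear.add_right[OF bounded_bilinear_matrix_mult]
  bounded_bilinear.diff_left[OF bounded_bilinear_matrix_mult]
  bounded_bilinear.diff_right[OF bounded_bilinear_matrix_mult]
  bounded_bilinear.minus_left[OF bounded_bilinear_matrix_mult]
  bounded_bilinear.minus_right[OF bounded_bilinear_matrix_mult]
  bounded_bilinear.scaleR_left[OF bounded_bilinear_matrix_mult]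
  bounded_bilinear.scaleR_right[OF bounded_bilinear_matrix_mult]

lemmas tendsto_matrix_mult = bounded_bilinear.tendsto[OF bounded_bilinear_matrix_mult]

lemma transpose_add: "transpose (M + N) = transpose M + transpose N"
  and transpose_diff: "transpose (M - N) = transpose M - transpose N"
  for M N :: "real^'n^'n"
  by (simp_all add: vec_eq_iff transpose_def)

lemma linear_transpose: "linear (transpose :: real^'n^'n \<Rightarrow> _)"
  by (rule linearI) (simp_all add: transpose_add transpose_scalar)

lemma transpose_sum: "transpose (\<Sum>i\<in>I. f i) = (\<Sum>i\<in>I. transpose (f i :: real^'n^'n))"
  by (rule linear_sum[OF linear_transpose])

lemma symmetric_mat_add: "symmetric_mat M \<Longrightarrow> symmetric_mat N \<Longrightarrow> symmetric_mat (M + N)"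
  and symmetric_mat_diff: "symmetric_mat M \<Longrightarrow> symmetric_mat N \<Longrightarrow> symmetric_mat (M - N)"
  and symmetric_mat_scaleR: "symmetric_mat M \<Longrightarrow> symmetric_mat (c *\<^sub>R M)"
  and symmetric_mat_mat: "symmetric_mat (mat k)"
  by (simp_all add: symmetric_mat_def transpose_add transpose_diff transpose_scalar)

lemma symmetric_mat_sum: "(\<And>i. i \<in> I \<Longrightarrow> symmetric_mat (f i)) \<Longrightarrow> symmetric_mat (\<Sum>i\<in>I. f i)"
  by (simp add: symmetric_mat_def transpose_sum)

lemma symmetric_mat_congruence:
  "symmetric_mat M \<Longrightarrow> symmetric_mat (W ** M ** transpose W)"
  by (simp add: symmetric_mat_def matrix_transpose_mul matrix_mul_assoc)

lemma trace_mult_eq_inner_symmetric: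
  "symmetric_mat M \<Longrightarrow> trace (M ** N) = M \<bullet> N"
  by (simp add: trace_mult_eq_inner symmetric_mat_def)

section \<open>Inverses and their continuity\<close>

lemma matrix_inv_mult:
  fixes M :: "real^'n^'n"
  assumes "invertible M"
  shows "M ** matrix_inv M = mat 1" "matrix_inv M ** M = mat 1"
proof -
  have "\<exists>B. M ** B = mat 1 \<and> B ** M = mat 1"
    using assms by (auto simp: invertible_def)
  from someI_ex[OF this] show "M ** matrix_inv M = mat 1" "matrix_inv M ** M = mat 1"
    unfolding matrix_inv_def by auto
qed

lemma matrix_inv_eqI:
  fixes M N :: "real^'n^'n"
  assumes "M ** N = mat 1"
  shows "matrix_inv M = N"
proof -
  have "invertible M"
    using assms invertible_right_inverse by auto
  then show ?thesis
    by (metis assms matrix_inv_mult(2) matrix_mul_assoc matrix_mul_lid matrix_mul_rid)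
qed

lemma symmetric_mat_inv:
  assumes "symmetric_mat M" "invertible M"
  shows "symmetric_mat (matrix_inv M)"
proof -
  have "matrix_inv M ** M = mat 1"
    using assms matrix_inv_mult by blast
  then have "M ** transpose (matrix_inv M) = mat 1"
    by (metis assms(1) matrix_transpose_mul symmetric_mat_def transpose_mat)
  then show ?thesis
    using matrix_inv_eqI by (metis symmetric_mat_def)
qed

lemma tendsto_det:
  fixes f :: "'a \<Rightarrow> real^'n^'n"
  assumes "(f \<longlongrightarrow> M) F"
  shows "((\<lambda>x. det (f x)) \<longlongrightarrow> det M) F"
  unfolding det_def by (intro tendsto_intros assms)

text \<open>Cramer's rule applied to column \<open>l\<close> of the inverse. Each entry becomes a
  quotient of determinants, which makes inversion continuous.\<close>

lemma matrix_inv_nth: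
  fixes M :: "real^'n^'n"
  assumes "invertible M"
  shows "matrix_inv M $ k $ l = det (\<chi> i j. if j = k then axis l 1 $ i else M$i$j) / det M"
proof -
  have "M *v (matrix_inv M *v axis l 1) = axis l 1"
    by (simp add: matrix_vector_mul_assoc matrix_inv_mult assms)
  then have "matrix_inv M *v axis l 1 = (\<chi> k. det (\<chi> i j. if j = k then axis l 1 $ i else M$i$j) / det M)"
    using cramer assms invertible_det_nz by blast
  moreover have "(matrix_inv M *v axis l 1) $ k = matrix_inv M $ k $ l"
    by (simp add: matrix_vector_mult_def axis_def if_distrib cong: if_cong)
  ultimately show ?thesis by simp
qed

lemma tendsto_matrix_inv:
  fixes f :: "'a \<Rightarrow> real^'n^'n"
  assumes f: "(f \<longlongrightarrow> M) F" and inv: "invertible M"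
  shows "((\<lambda>x. matrix_inv (f x)) \<longlongrightarrow> matrix_inv M) F"
proof -
  have dM: "det M \<noteq> 0" using inv invertible_det_nz by blast
  \<comment> \<open>Convergence of the determinants makes \<open>f x\<close> invertible eventually,
    which is enough for the limit.\<close>
  have ev: "eventually (\<lambda>x. det (f x) \<noteq> 0) F"
    by (rule tendsto_imp_eventually_ne[OF tendsto_det[OF f] dM])
  show ?thesis
  proof (intro vec_tendstoI)
    fix k l
    have num: "((\<lambda>x. det (\<chi> i j. if j = k then axis l 1 $ i else f x $i$j)) \<longlongrightarrow>
             det (\<chi> i j. if j = k then axis l 1 $ i else M$i$j)) F"
      by (intro tendsto_det tendsto_vec_lambda) (auto intro!: tendsto_vec_nth f)
    have "((\<lambda>x. det (\<chi> i j. if j = k then axis l 1 $ i else f x $i$j) / det (f x)) \<longlongrightarrow>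
             matrix_inv M $ k $ l) F"
      unfolding matrix_inv_nth[OF inv] by (rule tendsto_divide[OF num tendsto_det[OF f] dM])
    moreover have "eventually (\<lambda>x. det (\<chi> i j. if j = k then axis l 1 $ i else f x $i$j) / det (f x)
          = matrix_inv (f x) $ k $ l) F"
      using ev by eventually_elim (simp add: matrix_inv_nth invertible_det_nz)
    ultimately show "((\<lambda>x. matrix_inv (f x) $ k $ l) \<longlongrightarrow> matrix_inv M $ k $ l) F"
      by (rule Lim_transform_eventually)
  qed
qed

section \<open>The spectral theorem\<close>

lemma symmetric_mat_eigenvector:
  fixes M :: "real^'n^'n"
  assumes sym: "symmetric_mat M" and V: "subspace V" "V \<noteq> {0}"
    and inv: "\<And>x. x \<in> V \<Longrightarrow> M *v x \<in> V"
  obtains v c where "v \<in> V" "norm v = 1" "M *v v = c *\<^sub>R v"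
proof -
  \<comment> \<open>A maximiser v of the Rayleigh quotient on V: the form p below is nonnegative on V and vanishes at v.\<close>
  let ?S = "sphere 0 1 \<inter> V"
  obtain u where u: "u \<in> V" "u \<noteq> 0" using V subspace_0 by blast
  then have "(1 / norm u) *\<^sub>R u \<in> ?S"
    using V by (simp add: subspace_scale)
  then have ne: "?S \<noteq> {}" by blast
  have "compact ?S"
    using V by (intro compact_Int_closed closed_subspace) auto
  moreover have "continuous_on ?S (\<lambda>x. x \<bullet> (M *v x))"
    by (intro continuous_intros linear_continuous_on matrix_vector_mul_bounded_linear)
  ultimately obtain v where v: "v \<in> ?S" and vmax: "\<And>x. x \<in> ?S \<Longrightarrow> x \<bullet> (M *v x) \<le> v \<bullet> (M *v v)"
    using continuous_attains_sup[OF _ ne] by blast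
  define c where "c = v \<bullet> (M *v v)"
  define p where "p x = c * (x \<bullet> x) - x \<bullet> (M *v x)" for x
  have p_nonneg: "p x \<ge> 0" if "x \<in> V" for x
  proof (cases "x = 0")
    case False
    then have "(1 / norm x) *\<^sub>R x \<in> ?S"
      using V that by (simp add: subspace_scale)
    from vmax[OF this] have "(x \<bullet> (M *v x)) / (norm x)\<^sup>2 \<le> c"
      by (simp add: c_def matrix_vector_mult_scaleR power2_eq_square)
    then show ?thesis
      using False by (simp add: p_def field_simps power2_norm_eq_inner)
  qed (simp add: p_def)
  \<comment> \<open>Up to a factor 2, w is the gradient of p at its minimiser v; a step from v along
    -w would make p negative unless w = 0.\<close>
  define w where "w = c *\<^sub>R v - M *v v"
  have vV: "v \<in> V" "v \<bullet> v = 1" using v by (auto simp: norm_eq_1)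
  have wV: "w \<in> V"
    unfolding w_def using vV V inv by (simp add: subspace_diff subspace_scale)
  have expand: "p (v - e *\<^sub>R w) = e * (e * p w - 2 * (w \<bullet> w))" for e
  proof -
    have sw: "v \<bullet> (M *v w) = w \<bullet> (M *v v)"
      using inner_symmetric_mat[OF sym, of v w] by (simp add: inner_commute)
    have "w \<bullet> w = w \<bullet> (c *\<^sub>R v - M *v v)"
      by (simp only: w_def[symmetric])
    then have ww: "w \<bullet> w = c * (w \<bullet> v) - w \<bullet> (M *v v)"
      by (simp add: inner_diff_right)
    have "(v - e *\<^sub>R w) \<bullet> (v - e *\<^sub>R w) = 1 - 2 * e * (w \<bullet> v) + e\<^sup>2 * (w \<bullet> w)"
      using vV by (simp add: inner_diff_left inner_diff_right inner_commute[of v w] power2_eq_square algebra_simps)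
    moreover have "(v - e *\<^sub>R w) \<bullet> (M *v (v - e *\<^sub>R w))
        = c - 2 * e * (w \<bullet> (M *v v)) + e\<^sup>2 * (w \<bullet> (M *v w))"
      by (simp add: inner_diff_left inner_diff_right sw matrix_vector_mult_diff_distrib
          matrix_vector_mult_scaleR c_def power2_eq_square algebra_simps)
    ultimately have "p (v - e *\<^sub>R w) = c * (1 - 2 * e * (w \<bullet> v) + e\<^sup>2 * (w \<bullet> w))
        - (c - 2 * e * (w \<bullet> (M *v v)) + e\<^sup>2 * (w \<bullet> (M *v w)))"
      by (simp only: p_def)
    also have "\<dots> = e * (e * p w - 2 * (c * (w \<bullet> v) - w \<bullet> (M *v v)))"
      unfolding p_def by algebra
    finally show ?thesis by (simp only: ww)
  qed
  have "w \<bullet> w = 0"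
  proof (rule ccontr)
    assume "w \<bullet> w \<noteq> 0"
    then have ww: "w \<bullet> w > 0" by simp
    \<comment> \<open>With \<open>e * p w\<close> at most w . w, the second factor in
      \<open>expand\<close> is at most -(w . w); the summand 1 keeps the denominator
      positive.\<close>
    define e where "e = (w \<bullet> w) / (p w + 1)"
    have pw: "p w \<ge> 0" using p_nonneg wV by blast
    have e: "e > 0" "e * p w \<le> w \<bullet> w"
      using ww pw by (simp_all add: e_def field_simps)
    have "v - e *\<^sub>R w \<in> V" using V vV wV by (simp add: subspace_diff subspace_scale)
    then have "0 \<le> e * (e * p w - 2 * (w \<bullet> w))" using p_nonneg expand by metis
    then have "0 \<le> e * p w - 2 * (w \<bullet> w)" using e by (simp add: zero_le_mult_iff)
    then show False using e ww by linarith
  qed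
  then have "M *v v = c *\<^sub>R v" by (simp add: w_def)
  with v show ?thesis using that by auto
qed

text \<open>A symmetric matrix preserves orthogonality to its eigenvectors, so the complement of
  those already found is invariant, and while fewer than n are found it is nonzero and contains
  another one.\<close>

lemma symmetric_mat_orthonormal_eigenvectors:
  fixes M :: "real^'n^'n"
  assumes sym: "symmetric_mat M" and "k \<le> CARD('n)"
  shows "\<exists>B. finite B \<and> card B = k \<and> pairwise orthogonal B \<and>
    (\<forall>v\<in>B. norm v = 1 \<and> (\<exists>c. M *v v = c *\<^sub>R v))"
  using assms(2)
proof (induction k)
  case 0
  show ?case by (rule exI[of _ "{}"]) auto
next
  case (Suc k)
  then obtain B where B: "finite B" "card B = k" "pairwise orthogonal B"
     "\<forall>v\<in>B. norm v = 1 \<and> (\<exists>c. M *v v = c *\<^sub>R v)" by auto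
  define V where "V = {x. \<forall>b\<in>B. orthogonal b x}"
  have "dim B < DIM(real^'n)"
    using B(1,2) Suc.prems dim_le_card'[OF B(1)] by (simp add: DIM_cart)
  then obtain x where x: "x \<noteq> 0" "\<And>y. y \<in> span B \<Longrightarrow> orthogonal x y"
    using orthogonal_to_subspace_exists by blast
  then have "x \<in> V" by (auto simp: V_def span_base orthogonal_commute)
  then have ne: "V \<noteq> {0}" using x by blast
  have sub: "subspace V"
    unfolding V_def by (auto simp: subspace_def orthogonal_def inner_add_right)
  have "M *v x \<in> V" if "x \<in> V" for x
  proof -
    have "b \<bullet> (M *v x) = 0" if b: "b \<in> B" for b
    proof -
      obtain c where "M *v b = c *\<^sub>R b" using B b by blast
      then have "b \<bullet> (M *v x) = c * (b \<bullet> x)"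
        using inner_symmetric_mat[OF sym, of b x] by simp
      then show ?thesis using \<open>x \<in> V\<close> b by (simp add: V_def orthogonal_def)
    qed
    then show ?thesis by (simp add: V_def orthogonal_def)
  qed
  then obtain v c where v: "v \<in> V" "norm v = 1" "M *v v = c *\<^sub>R v"
    using symmetric_mat_eigenvector[OF sym sub ne] by blast
  have "v \<notin> B"
    using v by (auto simp: V_def orthogonal_def norm_eq_1)
  moreover have "pairwise orthogonal (insert v B)"
    using B(3) v(1) by (auto simp: pairwise_insert V_def orthogonal_commute)
  ultimately show ?case
    using B v by (intro exI[of _ "insert v B"]) auto
qed

lemma spectral_theorem_symmetric_mat:
  fixes M :: "real^'n^'n"
  assumes sym: "symmetric_mat M"
  obtains U d where "orthogonal_matrix U" "M = U ** diag_mat d ** transpose U"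
proof -
  obtain B where B: "finite B" "card B = CARD('n)" "pairwise orthogonal B"
     "\<forall>v\<in>B. norm v = 1 \<and> (\<exists>c. M *v v = c *\<^sub>R v)"
    using symmetric_mat_orthonormal_eigenvectors[OF sym order_refl] by blast
  obtain f :: "'n \<Rightarrow> real^'n" where f: "bij_betw f UNIV B"
    using B(1,2) finite_same_card_bij[of "UNIV :: 'n set" B] by auto
  have fB: "f i \<in> B" for i using f by (auto simp: bij_betw_def)
  obtain d where d: "\<And>i. M *v f i = d i *\<^sub>R f i"
    using B(4) fB choice[of "\<lambda>i c. M *v f i = c *\<^sub>R f i"] by blast
  define U :: "real^'n^'n" where "U = (\<chi> i j. f j $ i)"
  have "f i \<bullet> f j = (if i = j then 1 else 0)" for i j
  proof (cases "i = j")
    case True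
    then show ?thesis using B(4) fB by (simp add: norm_eq_1)
  next
    case False
    then have "f i \<noteq> f j" using f by (metis UNIV_I bij_betw_imp_inj_on inj_on_def)
    then show ?thesis using False B(3) fB by (simp add: pairwise_def orthogonal_def)
  qed
  then have "transpose U ** U = mat 1"
    by (simp add: vec_eq_iff matrix_matrix_mult_def transpose_def U_def mat_def inner_vec_def)
  then have orth: "orthogonal_matrix U" by (simp add: orthogonal_matrix)
  have "(M ** U) $ i $ j = (U ** diag_mat d) $ i $ j" for i j
  proof -
    have "(M ** U) $ i $ j = (M *v f j) $ i"
      by (simp add: matrix_matrix_mult_def matrix_vector_mult_def U_def)
    also have "\<dots> = (U ** diag_mat d) $ i $ j"
      by (simp add: d matrix_matrix_mult_def U_def diag_mat_nth if_distrib[of "\<lambda>x. _ * x"] cong: if_cong)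
    finally show ?thesis .
  qed
  then have "M ** U = U ** diag_mat d" by (simp add: vec_eq_iff)
  then have "M = U ** diag_mat d ** transpose U"
    using orth by (metis matrix_mul_assoc matrix_mul_rid orthogonal_matrix_def)
  with orth show ?thesis by (rule that)
qed

section \<open>Definiteness read off the spectrum\<close>

lemma pos_def_imp_pos_semidef: "pos_def X \<Longrightarrow> pos_semidef X"
  unfolding pos_def_def pos_semidef_def by (metis inner_zero_left order.strict_implies_order order_refl)

lemma pos_def_symmetric: "pos_def X \<Longrightarrow> symmetric_mat X"
  and pos_semidef_symmetric: "pos_semidef X \<Longrightarrow> symmetric_mat X"
  by (simp_all add: pos_def_def pos_semidef_def)

lemma pos_def_invertible:
  assumes "pos_def X" shows "invertible X"
proof -
  have "x = 0" if "X *v x = 0" for x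
    using assms that by (metis inner_zero_right less_irrefl pos_def_def)
  then have "\<exists>B. B ** X = mat 1" by (simp add: matrix_left_invertible_ker)
  then show ?thesis using invertible_left_inverse by blast
qed

lemma pos_def_inv_symmetric: "pos_def X \<Longrightarrow> symmetric_mat (matrix_inv X)"
  by (simp add: pos_def_invertible pos_def_symmetric symmetric_mat_inv)

text \<open>Column \<open>i\<close> of U is a unit eigenvector, so its Rayleigh value is
  \<open>d i\<close>; definiteness of M thereby becomes a sign condition on d.\<close>

lemma spectral_entry:
  fixes U :: "real^'n^'n"
  assumes "orthogonal_matrix U" "M = U ** diag_mat d ** transpose U"
  shows "d i = column i U \<bullet> (M *v column i U)" "column i U \<noteq> 0"
proof -
  have e: "transpose U *v column i U = axis i 1"
  proof -
    have "column i U = U *v axis i 1" by (simp add: matrix_vector_mult_basis)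
    then show ?thesis using assms(1)
      by (simp add: matrix_vector_mul_assoc orthogonal_matrix_def del: transpose_matrix_vector)
  qed
  have "column i U \<bullet> (M *v column i U) = axis i 1 \<bullet> (diag_mat d *v axis i 1)"
    unfolding assms(2) inner_congruence e ..
  also have "\<dots> = d i"
    by (simp add: inner_diag_mat_vec axis_def if_distrib[of "\<lambda>x. _ * x"] if_distrib[of "\<lambda>x. x^2"] cong: if_cong)
  finally show "d i = column i U \<bullet> (M *v column i U)" ..
  show "column i U \<noteq> 0" using e by (metis axis_eq_0_iff matrix_vector_mult_0_right zero_neq_one)
qed

lemma pos_semidef_spectral:
  fixes X :: "real^'n^'n"
  assumes "pos_semidef X"
  shows "\<exists>U d. orthogonal_matrix U \<and> X = U ** diag_mat d ** transpose U \<and> (\<forall>i. d i \<ge> 0)"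
proof -
  obtain U d where U: "orthogonal_matrix U" "X = U ** diag_mat d ** transpose U"
    using assms pos_semidef_symmetric spectral_theorem_symmetric_mat by blast
  moreover have "d i \<ge> 0" for i
    using spectral_entry(1)[OF U, of i] assms by (simp add: pos_semidef_def)
  ultimately show ?thesis by blast
qed

lemma pos_def_spectral:
  fixes X :: "real^'n^'n"
  assumes "pos_def X"
  shows "\<exists>U d. orthogonal_matrix U \<and> X = U ** diag_mat d ** transpose U \<and> (\<forall>i. d i > 0)"
proof -
  obtain U d where U: "orthogonal_matrix U" "X = U ** diag_mat d ** transpose U"
    using assms pos_def_symmetric spectral_theorem_symmetric_mat by blast
  moreover have "d i > 0" for i
    using spectral_entry[OF U, of i] assms by (simp add: pos_def_def)
  ultimately show ?thesis by blast
qed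

lemma matrix_congruence_diagonal_nth:
  fixes U Q :: "real^'n^'n"
  shows "(transpose U ** Q ** U) $ i $ i = column i U \<bullet> (Q *v column i U)"
proof -
  have "(transpose U ** Q ** U) $ i $ i = (transpose U ** (Q ** U)) $ i $ i"
    by (simp add: matrix_mul_assoc)
  also have "\<dots> = column i U \<bullet> (Q *v column i U)"
    by (simp add: matrix_matrix_mult_def transpose_def inner_vec_def column_def matrix_vector_mult_def)
  finally show ?thesis .
qed

lemma inner_congruence_left:
  fixes W D Q :: "real^'n^'n"
  shows "(W ** D ** transpose W) \<bullet> Q = D \<bullet> (transpose W ** Q ** W)"
  by (simp only: inner_matrix_mult_right[of "W ** D"] inner_matrix_mult_left[of W]
      transpose_transpose matrix_mul_assoc)

text \<open>One half of the self-duality of the semidefinite cone: once P is diagonal, the pairing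
  is a nonnegative combination of Rayleigh values of Q.\<close>

lemma pos_semidef_inner_nonneg:
  fixes P Q :: "real^'n^'n"
  assumes "pos_semidef P" "pos_semidef Q"
  shows "P \<bullet> Q \<ge> 0"
proof -
  obtain U :: "real^'n^'n" and d where U: "P = U ** diag_mat d ** transpose U" and d: "\<And>i. d i \<ge> 0"
    using pos_semidef_spectral[OF assms(1)] by blast
  have "P \<bullet> Q = diag_mat d \<bullet> (transpose U ** Q ** U)"
    unfolding U by (rule inner_congruence_left)
  also have "\<dots> = (\<Sum>i\<in>UNIV. d i * (column i U \<bullet> (Q *v column i U)))"
    by (simp add: inner_diag_mat matrix_congruence_diagonal_nth)
  also have "\<dots> \<ge> 0"
    using d assms(2) by (intro sum_nonneg mult_nonneg_nonneg) (auto simp: pos_semidef_def)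
  finally show ?thesis .
qed

text \<open>Factor X as R R^T with R invertible, diagonalise R^{-1} D R^{-T} by an orthogonal V, and
  take W = R V: the rotation V leaves R R^T unchanged.\<close>

lemma simultaneous_diagonalization:
  fixes X D :: "real^'n^'n"
  assumes X: "pos_def X" and D: "symmetric_mat D"
  obtains W :: "real^'n^'n" and d where "invertible W" "X = W ** transpose W" "D = W ** diag_mat d ** transpose W"
proof -
  obtain U e where U: "orthogonal_matrix U" "X = U ** diag_mat e ** transpose U" and e: "\<And>i. e i > 0"
    using pos_def_spectral[OF X] by blast
  define R where "R = U ** diag_mat (\<lambda>i. sqrt (e i))"
  define R' where "R' = diag_mat (\<lambda>i. 1 / sqrt (e i)) ** transpose U"
  have e0: "e i \<noteq> 0" for i using e[of i] by simp
  have XR: "X = R ** transpose R"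
  proof -
    have "R ** transpose R = U ** (diag_mat (\<lambda>i. sqrt (e i)) ** diag_mat (\<lambda>i. sqrt (e i))) ** transpose U"
      by (simp add: R_def matrix_transpose_mul matrix_mul_assoc)
    then show ?thesis using e by (simp add: U(2) diag_mat_mult order_less_imp_le)
  qed
  have RR': "R ** R' = mat 1"
  proof -
    have "R ** R' = U ** (diag_mat (\<lambda>i. sqrt (e i)) ** diag_mat (\<lambda>i. 1 / sqrt (e i))) ** transpose U"
      by (simp add: R_def R'_def matrix_mul_assoc)
    then show ?thesis using U(1) e0 by (simp add: diag_mat_mult diag_mat_one orthogonal_matrix_def)
  qed
  have tRR': "transpose R' ** transpose R = mat 1"
    using RR' by (metis matrix_transpose_mul transpose_mat)
  obtain V d where V: "orthogonal_matrix V" "R' ** D ** transpose R' = V ** diag_mat d ** transpose V"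
    by (rule spectral_theorem_symmetric_mat[OF symmetric_mat_congruence[OF D]])
  define W where "W = R ** V"
  have "W ** transpose W = R ** (V ** transpose V) ** transpose R"
    by (simp add: W_def matrix_transpose_mul matrix_mul_assoc)
  then have 1: "X = W ** transpose W" using V(1) by (simp add: XR orthogonal_matrix_def)
  have "W ** diag_mat d ** transpose W = R ** (V ** diag_mat d ** transpose V) ** transpose R"
    by (simp add: W_def matrix_transpose_mul matrix_mul_assoc)
  also have "\<dots> = (R ** R') ** D ** (transpose R' ** transpose R)"
    unfolding V(2)[symmetric] by (simp add: matrix_mul_assoc)
  also have "\<dots> = D" by (simp add: RR' tRR')
  finally have 2: "D = W ** diag_mat d ** transpose W" ..
  have "invertible W"
    unfolding W_def using RR' V(1)
    by (intro invertible_mult) (auto simp: invertible_right_inverse orthogonal_matrix_def)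
  from this 1 2 show ?thesis by (rule that)
qed

section \<open>Positive definite matrices and log-determinants\<close>

lemma pos_semidef_diag_congruence:
  fixes W :: "real^'n^'n"
  assumes "\<And>i. d i \<ge> 0"
  shows "pos_semidef (W ** diag_mat d ** transpose W)"
  unfolding pos_semidef_def
proof (intro conjI allI)
  show "symmetric_mat (W ** diag_mat d ** transpose W)"
    by (intro symmetric_mat_congruence) (simp add: symmetric_mat_def)
  show "0 \<le> x \<bullet> (W ** diag_mat d ** transpose W *v x)" for x
    unfolding inner_congruence inner_diag_mat_vec
    by (intro sum_nonneg mult_nonneg_nonneg assms) auto
qed

lemma diag_mat_scaleR_one: "diag_mat (\<lambda>_. c) = c *\<^sub>R mat 1"
  by (simp add: vec_eq_iff diag_mat_nth mat_def)

lemma diag_mat_diff: "diag_mat (\<lambda>i. d i - e i) = diag_mat d - diag_mat e"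
  and diag_mat_add: "diag_mat (\<lambda>i. d i + e i) = diag_mat d + diag_mat e"
  and diag_mat_scaleR: "diag_mat (\<lambda>i. c * d i) = c *\<^sub>R diag_mat d"
  by (simp_all add: vec_eq_iff diag_mat_nth)

lemma trace_orthogonal_diag:
  fixes U :: "real^'n^'n"
  assumes "orthogonal_matrix U"
  shows "trace (U ** diag_mat d ** transpose U) = (\<Sum>i\<in>UNIV. d i)"
proof -
  have "trace (U ** diag_mat d ** transpose U) = (U ** diag_mat d ** transpose U) \<bullet> mat 1"
    by (simp add: inner_mat_one inner_commute)
  also have "\<dots> = (\<Sum>i\<in>UNIV. d i)"
    using assms unfolding inner_congruence_left
    by (simp add: inner_diag_mat orthogonal_matrix_def) (simp add: mat_def)
  finally show ?thesis .
qed

lemma orthogonal_diag_scaleR_one: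
  fixes U :: "real^'n^'n"
  assumes "orthogonal_matrix U"
  shows "U ** diag_mat (\<lambda>_. c) ** transpose U = c *\<^sub>R mat 1"
  using assms by (simp add: diag_mat_scaleR_one matrix_mult_simps orthogonal_matrix_def)

text \<open>No eigenvalue of a semidefinite matrix exceeds the sum of all of them.\<close>

lemma pos_semidef_trace_diff:
  fixes X :: "real^'n^'n"
  assumes "pos_semidef X"
  shows "pos_semidef (trace X *\<^sub>R mat 1 - X)"
proof -
  obtain U :: "real^'n^'n" and d where U: "orthogonal_matrix U" "X = U ** diag_mat d ** transpose U"
    and d: "\<forall>i. d i \<ge> 0"
    using pos_semidef_spectral[OF assms] by blast
  have "trace X *\<^sub>R mat 1 - X = U ** diag_mat (\<lambda>i. trace X - d i) ** transpose U"
    unfolding diag_mat_diff matrix_mult_simps orthogonal_diag_scaleR_one[OF U(1)] U(2)[symmetric] ..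
  moreover have "d i \<le> trace X" for i
    unfolding U(2) trace_orthogonal_diag[OF U(1)] using d by (intro member_le_sum) auto
  ultimately show ?thesis by (simp add: pos_semidef_diag_congruence)
qed

text \<open>Pairing X with tr(X) I - X, both semidefinite, bounds X . X by the square of the
  trace.\<close>

lemma pos_semidef_norm_le_trace:
  fixes X :: "real^'n^'n"
  assumes "pos_semidef X"
  shows "norm X \<le> trace X"
proof -
  have "X \<bullet> (trace X *\<^sub>R mat 1 - X) \<ge> 0"
    using pos_semidef_inner_nonneg assms pos_semidef_trace_diff by blast
  then have "X \<bullet> X \<le> (trace X)\<^sup>2"
    by (simp add: inner_diff_right inner_commute[of X "mat 1"] inner_mat_one power2_eq_square)
  moreover have "trace X \<ge> 0"
  proof -
    have "pos_semidef (mat 1 :: real^'n^'n)"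
      by (simp add: pos_semidef_def symmetric_mat_mat)
    from pos_semidef_inner_nonneg[OF this assms] show ?thesis by (simp add: inner_mat_one)
  qed
  ultimately show ?thesis
    by (simp add: norm_eq_sqrt_inner real_le_lsqrt)
qed

lemma pos_def_trace_pos:
  assumes "pos_def X" shows "trace X > 0"
proof -
  have "X \<noteq> 0"
    using assms unfolding pos_def_def
    by (metis axis_eq_0_iff inner_zero_right less_irrefl matrix_vector_mult_0 zero_neq_one)
  then have "0 < norm X" by simp
  also have "\<dots> \<le> trace X"
    by (rule pos_semidef_norm_le_trace[OF pos_def_imp_pos_semidef[OF assms]])
  finally show ?thesis .
qed

lemma pos_def_det_pos:
  fixes X :: "real^'n^'n"
  assumes "pos_def X" shows "det X > 0"
proof -
  obtain U :: "real^'n^'n" and d where U: "orthogonal_matrix U" "X = U ** diag_mat d ** transpose U"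
    and d: "\<forall>i. d i > 0"
    using pos_def_spectral[OF assms] by blast
  have "det X = (det U)\<^sup>2 * (\<Prod>i\<in>UNIV. d i)"
    unfolding U(2) by (simp add: det_mul det_diag_mat power2_eq_square)
  moreover have "det U \<noteq> 0" using det_orthogonal_matrix[OF U(1)] by auto
  ultimately show ?thesis using d by (simp add: prod_pos)
qed

text \<open>In diagonal form a vanishing quadratic form forces X x = 0. The lemma lets closed
  conditions, semidefiniteness and a determinant bound, replace the open condition of
  definiteness.\<close>

lemma pos_semidef_det_pos_imp_pos_def:
  fixes X :: "real^'n^'n"
  assumes "pos_semidef X" "det X \<noteq> 0"
  shows "pos_def X"
proof -
  obtain W :: "real^'n^'n" and d where W: "X = W ** diag_mat d ** transpose W" and d: "\<forall>i. d i \<ge> 0"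
    using pos_semidef_spectral[OF assms(1)] by blast
  have X: "x \<bullet> (X *v x) = (\<Sum>i\<in>UNIV. d i * ((transpose W *v x) $ i)\<^sup>2)" for x
    unfolding W inner_congruence inner_diag_mat_vec ..
  have "x \<bullet> (X *v x) > 0" if "x \<noteq> 0" for x
  proof -
    have "x \<bullet> (X *v x) \<noteq> 0"
    proof
      assume "x \<bullet> (X *v x) = 0"
      then have "\<forall>i. d i * ((transpose W *v x) $ i)\<^sup>2 = 0"
        unfolding X using d by (subst (asm) sum_nonneg_eq_0_iff) auto
      then have "diag_mat d *v (transpose W *v x) = 0"
        by (auto simp: vec_eq_iff diag_mat_mult_vec)
      then have "X *v x = 0" unfolding W matrix_vector_mul_assoc[symmetric] by simp
      moreover have "invertible X" using assms(2) by (simp add: invertible_det_nz)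
      ultimately have "x = 0"
        by (metis invertible_def matrix_left_invertible_ker)
      then show False using that by simp
    qed
    then show ?thesis using assms(1) by (simp add: pos_semidef_def order_less_le)
  qed
  then show ?thesis using assms(1) by (simp add: pos_def_def pos_semidef_def)
qed

lemma pos_def_inv:
  fixes X :: "real^'n^'n"
  assumes "pos_def X" shows "pos_def (matrix_inv X)"
  unfolding pos_def_def
proof (intro conjI allI impI)
  show "symmetric_mat (matrix_inv X)" by (rule pos_def_inv_symmetric[OF assms])
  fix x :: "real^'n" assume x: "x \<noteq> 0"
  define y where "y = matrix_inv X *v x"
  have xy: "x = X *v y"
    by (simp add: y_def matrix_vector_mul_assoc matrix_inv_mult pos_def_invertible assms)
  then have "y \<noteq> 0" using x by auto
  then have "y \<bullet> (X *v y) > 0" using assms by (simp add: pos_def_def)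
  then show "0 < x \<bullet> (matrix_inv X *v x)"
    unfolding y_def[symmetric] using xy by (simp add: inner_commute)
qed

lemma matrix_inv_matrix_inv: "invertible X \<Longrightarrow> matrix_inv (matrix_inv X) = X"
  for X :: "real^'n^'n"
  by (rule matrix_inv_eqI) (rule matrix_inv_mult(2))

text \<open>The eigenvalues of X are at most its trace, hence at most K, so those of the inverse are
  at least 1 / K. A trace bound along a family thus becomes a uniform lower bound for the
  inverses.\<close>

lemma pos_def_inv_ge:
  fixes X :: "real^'n^'n"
  assumes X: "pos_def X" and K: "trace X \<le> K"
  shows "pos_semidef (matrix_inv X - (1 / K) *\<^sub>R mat 1)"
proof -
  obtain U :: "real^'n^'n" and d where U: "orthogonal_matrix U" "X = U ** diag_mat d ** transpose U"
    and d: "\<forall>i. d i > 0"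
    using pos_def_spectral[OF X] by blast
  have d0: "d i \<noteq> 0" for i using d by (metis less_irrefl)
  have "X ** (U ** diag_mat (\<lambda>i. 1 / d i) ** transpose U)
      = U ** (diag_mat d ** (transpose U ** U) ** diag_mat (\<lambda>i. 1 / d i)) ** transpose U"
    unfolding U(2) by (simp add: matrix_mul_assoc)
  also have "\<dots> = mat 1"
    using U(1) d0 by (simp add: orthogonal_matrix_def diag_mat_mult diag_mat_one)
  finally have inv: "matrix_inv X = U ** diag_mat (\<lambda>i. 1 / d i) ** transpose U"
    by (rule matrix_inv_eqI)
  have "matrix_inv X - (1 / K) *\<^sub>R mat 1 = U ** diag_mat (\<lambda>i. 1 / d i - 1 / K) ** transpose U"
    unfolding diag_mat_diff matrix_mult_simps orthogonal_diag_scaleR_one[OF U(1)] inv ..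
  moreover have "1 / K \<le> 1 / d i" for i
  proof -
    have "d i \<le> trace X"
      unfolding U(2) trace_orthogonal_diag[OF U(1)] using d by (intro member_le_sum) (auto intro: less_imp_le)
    moreover have "0 < d i" using d by blast
    ultimately show ?thesis using K by (intro divide_left_mono) auto
  qed
  ultimately show ?thesis by (simp add: pos_semidef_diag_congruence)
qed

text \<open>The preceding bound, applied to the inverse of X.\<close>

lemma pos_def_ge_mat_one:
  fixes X :: "real^'n^'n"
  assumes "pos_def X"
  obtains k where "k > 0" "pos_semidef (X - k *\<^sub>R mat 1)"
proof
  show "1 / trace (matrix_inv X) > 0"
    using assms by (simp add: pos_def_inv pos_def_trace_pos)
  show "pos_semidef (X - (1 / trace (matrix_inv X)) *\<^sub>R mat 1)"
    using pos_def_inv_ge[OF pos_def_inv[OF assms] order_refl]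
    by (simp add: matrix_inv_matrix_inv pos_def_invertible assms)
qed

lemma pos_semidef_diff_mat_one_iff:
  "pos_semidef (X - k *\<^sub>R mat 1) \<longleftrightarrow> symmetric_mat X \<and> (\<forall>x. k * (x \<bullet> x) \<le> x \<bullet> (X *v x))"
proof -
  have "symmetric_mat (X - k *\<^sub>R mat 1) = symmetric_mat X"
    by (simp add: symmetric_mat_def transpose_diff transpose_scalar)
  then show ?thesis
    by (simp add: pos_semidef_def matrix_vector_mult_diff_rdistrib inner_diff_right
        scaleR_matrix_vector_assoc[symmetric])
qed

text \<open>The Frobenius norm dominates the operator norm, so a lower eigenvalue bound k of Z is an
  admissible radius. Symmetry of W is imposed because definiteness includes it.\<close>

lemma pos_def_open:
  fixes Z :: "real^'n^'n"
  assumes "pos_def Z"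
  obtains e where "e > 0" "\<And>W. symmetric_mat W \<Longrightarrow> norm (W - Z) < e \<Longrightarrow> pos_def W"
proof -
  obtain k where k: "k > 0" "pos_semidef (Z - k *\<^sub>R mat 1)"
    using pos_def_ge_mat_one[OF assms] by blast
  have "pos_def W" if W: "symmetric_mat W" "norm (W - Z) < k" for W
    unfolding pos_def_def
  proof (intro conjI allI impI)
    fix x :: "real^'n" assume "x \<noteq> 0"
    have "\<bar>x \<bullet> ((W - Z) *v x)\<bar> \<le> norm x * norm ((W - Z) *v x)"
      by (rule Cauchy_Schwarz_ineq2)
    also have "\<dots> \<le> norm x * (norm (W - Z) * norm x)"
      by (intro mult_left_mono norm_matrix_vector_mult_le) auto
    also have "\<dots> < k * (x \<bullet> x)"
      using W(2) \<open>x \<noteq> 0\<close> by (simp add: dot_square_norm power2_eq_square)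
    finally have "\<bar>x \<bullet> ((W - Z) *v x)\<bar> < k * (x \<bullet> x)" .
    moreover have "k * (x \<bullet> x) \<le> x \<bullet> (Z *v x)"
      using k(2) by (simp add: pos_semidef_diff_mat_one_iff)
    ultimately show "0 < x \<bullet> (W *v x)"
      by (simp add: matrix_vector_mult_diff_rdistrib inner_diff_right)
  qed (rule W)
  with k(1) show ?thesis by (rule that)
qed

lemma pos_semidef_congruence:
  "pos_semidef Q \<Longrightarrow> pos_semidef (W ** Q ** transpose W)" for W :: "real^'n^'n"
  unfolding pos_semidef_def inner_congruence by (simp add: symmetric_mat_congruence)

text \<open>Coercivity with two different weights: P is first replaced by k I against the
  semidefinite D Q D, then Q by k I against D D. Along the path, P and Q are the inverses at two
  times.\<close>

lemma inner_sandwich_ge: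
  fixes P Q D :: "real^'n^'n"
  assumes P: "pos_semidef (P - k *\<^sub>R mat 1)" and Q: "pos_semidef (Q - k *\<^sub>R mat 1)"
    and k: "k > 0" and D: "symmetric_mat D"
  shows "k\<^sup>2 * (D \<bullet> D) \<le> (P ** D ** Q) \<bullet> D"
proof -
  have tD: "transpose D = D" using D by (simp add: symmetric_mat_def)
  have tQ: "transpose Q = Q" using Q by (simp add: pos_semidef_diff_mat_one_iff symmetric_mat_def)
  have Qp: "pos_semidef Q"
    unfolding pos_semidef_def
  proof (intro conjI allI)
    show "symmetric_mat Q" using tQ by (simp add: symmetric_mat_def)
    fix x :: "real^'n"
    have "0 \<le> k * (x \<bullet> x)" using k by simp
    also have "\<dots> \<le> x \<bullet> (Q *v x)" using Q by (simp add: pos_semidef_diff_mat_one_iff)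
    finally show "0 \<le> x \<bullet> (Q *v x)" .
  qed
  have DD: "mat 1 \<bullet> (D ** D) = D \<bullet> D"
    by (simp add: inner_mat_one trace_mult_eq_inner_symmetric[OF D])
  have "(P ** D ** Q) \<bullet> D = P \<bullet> (D ** Q ** D)"
    using inner_matrix_mult_right[of P "D ** Q" D] by (simp add: matrix_transpose_mul tD tQ matrix_mul_assoc)
  moreover have "(P - k *\<^sub>R mat 1) \<bullet> (D ** Q ** D) \<ge> 0"
    using pos_semidef_inner_nonneg[OF P pos_semidef_congruence[OF Qp, of D]] by (simp add: tD)
  moreover have "mat 1 \<bullet> (D ** Q ** D) = Q \<bullet> (D ** D)"
    using inner_congruence_left[of D Q "mat 1"] by (simp add: tD inner_commute)
  moreover have "(Q - k *\<^sub>R mat 1) \<bullet> (D ** D) \<ge> 0"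
  proof -
    have "pos_semidef (D ** mat 1 ** transpose D)"
      by (intro pos_semidef_congruence) (simp add: pos_semidef_def symmetric_mat_mat)
    then show ?thesis using pos_semidef_inner_nonneg[OF Q] by (simp add: tD)
  qed
  ultimately have 1: "k * (Q \<bullet> (D ** D)) \<le> (P ** D ** Q) \<bullet> D" and 2: "k * (D \<bullet> D) \<le> Q \<bullet> (D ** D)"
    using DD by (simp_all add: inner_diff_left)
  show ?thesis
    using mult_left_mono[OF 2 less_imp_le[OF k]] 1 by (simp add: power2_eq_square mult.assoc)
qed

text \<open>The \<open>d i\<close> are the eigenvalues of X^{-1} D. In the coordinates of W the line
  through X is diagonal, so pairing, determinant and definiteness along it reduce to the scalars
  \<open>1 + e * d i\<close>.\<close>

lemma pos_def_line:
  fixes X D :: "real^'n^'n"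
  assumes X: "pos_def X" and D: "symmetric_mat D"
  obtains d where "matrix_inv X \<bullet> D = (\<Sum>i\<in>UNIV. d i)"
    "\<And>e. det (X + e *\<^sub>R D) = det X * (\<Prod>i\<in>(UNIV::'n set). 1 + e * d i)"
    "\<And>e. pos_def (X + e *\<^sub>R D) \<longleftrightarrow> (\<forall>i. 1 + e * d i > 0)"
    "(\<forall>i. d i = 0) \<Longrightarrow> D = 0"
proof -
  obtain W :: "real^'n^'n" and d where W: "invertible W" "X = W ** transpose W"
    "D = W ** diag_mat d ** transpose W"
    by (rule simultaneous_diagonalization[OF X D])
  define V where "V = matrix_inv W"
  have V: "W ** V = mat 1" "V ** W = mat 1"
    using matrix_inv_mult[OF W(1)] by (simp_all add: V_def)
  have tV: "transpose V ** transpose W = mat 1" "transpose W ** transpose V = mat 1"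
    by (simp_all add: V flip: matrix_transpose_mul)
  have "X ** (transpose V ** V) = W ** (transpose W ** transpose V) ** V"
    by (simp add: W(2) matrix_mul_assoc)
  then have inv: "matrix_inv X = transpose V ** V"
    by (intro matrix_inv_eqI) (simp add: tV V)
  have "transpose W ** matrix_inv X ** W = (transpose W ** transpose V) ** (V ** W)"
    by (simp add: inv matrix_mul_assoc)
  then have one: "transpose W ** matrix_inv X ** W = mat 1" by (simp add: tV V)
  have 1: "matrix_inv X \<bullet> D = (\<Sum>i\<in>UNIV. d i)"
    by (subst inner_commute) (simp add: W(3) inner_congruence_left one inner_diag_mat, simp add: mat_def)
  have line: "X + e *\<^sub>R D = W ** diag_mat (\<lambda>i. 1 + e * d i) ** transpose W" for e
    by (simp add: diag_mat_add diag_mat_scaleR matrix_mult_simps diag_mat_one W(2,3))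
  have 2: "det (X + e *\<^sub>R D) = det X * (\<Prod>i\<in>(UNIV::'n set). 1 + e * d i)" for e
    unfolding line by (simp add: det_mul det_diag_mat W(2))
  have 3: "pos_def (X + e *\<^sub>R D) \<longleftrightarrow> (\<forall>i. 1 + e * d i > 0)" for e
  proof
    assume pd: "pos_def (X + e *\<^sub>R D)"
    show "\<forall>i. 1 + e * d i > 0"
    proof
      fix i
      \<comment> \<open>The transpose of W sends x to the basis vector \<open>axis i 1\<close>, so
        the quadratic form at x isolates the diagonal entry \<open>i\<close>.\<close>
      define x where "x = transpose V *v axis i 1"
      have Wx: "transpose W *v x = axis i 1"
        unfolding x_def matrix_vector_mul_assoc tV by simp
      then have "x \<noteq> 0" by (metis axis_eq_0_iff matrix_vector_mult_0_right zero_neq_one)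
      then have "0 < x \<bullet> ((X + e *\<^sub>R D) *v x)" using pd by (simp add: pos_def_def)
      also have "\<dots> = 1 + e * d i"
        unfolding line inner_congruence Wx inner_diag_mat_vec
        by (simp add: axis_def if_distrib[of "\<lambda>x. _ * x"] if_distrib[of "\<lambda>x. x^2"] cong: if_cong)
      finally show "1 + e * d i > 0" .
    qed
  next
    assume pos: "\<forall>i. 1 + e * d i > 0"
    then have "pos_semidef (X + e *\<^sub>R D)"
      unfolding line by (intro pos_semidef_diag_congruence) (simp add: less_imp_le)
    moreover have "det (X + e *\<^sub>R D) \<noteq> 0"
      unfolding 2 using pos_def_det_pos[OF X] pos
      by (metis less_irrefl mult_pos_pos prod_pos)
    ultimately show "pos_def (X + e *\<^sub>R D)" by (rule pos_semidef_det_pos_imp_pos_def)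
  qed
  have 4: "D = 0" if "\<forall>i. d i = 0"
  proof -
    have "diag_mat d = 0" using that by (simp add: vec_eq_iff diag_mat_nth)
    then show ?thesis by (simp add: W(3) matrix_matrix_mult_def vec_eq_iff)
  qed
  from 1 2 3 4 show ?thesis by (rule that)
qed

text \<open>Sum \<open>ln (1 + d i) \<le> d i\<close> over the eigenvalues of X^{-1} (Y - X).
  Equality of the sums forces equality in each term, hence d = 0; this strictness is the source of
  all uniqueness below.\<close>

lemma logdet_gap:
  fixes X Y :: "real^'n^'n"
  assumes X: "pos_def X" and Y: "pos_def Y"
  shows "ln (det Y) - ln (det X) \<le> matrix_inv X \<bullet> (Y - X)"
    and "matrix_inv X \<bullet> (Y - X) \<le> ln (det Y) - ln (det X) \<Longrightarrow> Y = X"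
proof -
  have "symmetric_mat (Y - X)"
    using X Y by (simp add: pos_def_symmetric symmetric_mat_diff)
  from pos_def_line[OF X this] obtain d where d: "matrix_inv X \<bullet> (Y - X) = (\<Sum>i\<in>UNIV. d i)"
    "\<And>e. det (X + e *\<^sub>R (Y - X)) = det X * (\<Prod>i\<in>(UNIV::'n set). 1 + e * d i)"
    "\<And>e. pos_def (X + e *\<^sub>R (Y - X)) \<longleftrightarrow> (\<forall>i. 1 + e * d i > 0)"
    "(\<forall>i. d i = 0) \<Longrightarrow> Y - X = 0" by metis
  have pos: "1 + d i > 0" for i using d(3)[of 1] Y by simp
  have "ln (det Y) = ln (det X * (\<Prod>i\<in>(UNIV::'n set). 1 + d i))"
    using d(2)[of 1] by simp
  also have "\<dots> = ln (det X) + ln (\<Prod>i\<in>(UNIV::'n set). 1 + d i)"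
    using pos_def_det_pos[OF X] pos by (intro ln_mult_pos) (auto intro: prod_pos)
  also have "ln (\<Prod>i\<in>(UNIV::'n set). 1 + d i) = (\<Sum>i\<in>UNIV. ln (1 + d i))"
    using pos by (intro ln_prod) (simp_all add: less_imp_neq[symmetric])
  finally have ld: "ln (det Y) - ln (det X) = (\<Sum>i\<in>UNIV. ln (1 + d i))" by simp
  have le: "ln (1 + d i) \<le> d i" for i using ln_add_one_self_le_self2 pos[of i] by simp
  then show "ln (det Y) - ln (det X) \<le> matrix_inv X \<bullet> (Y - X)"
    unfolding ld d(1) by (intro sum_mono)
  assume "matrix_inv X \<bullet> (Y - X) \<le> ln (det Y) - ln (det X)"
  then have "(\<Sum>i\<in>UNIV. d i - ln (1 + d i)) \<le> 0"
    unfolding ld d(1) by (simp add: sum_subtractf)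
  moreover have "(\<Sum>i\<in>UNIV. d i - ln (1 + d i)) \<ge> 0"
    using le by (intro sum_nonneg) simp
  ultimately have "(\<Sum>i\<in>UNIV. d i - ln (1 + d i)) = 0" by simp
  then have eq: "ln (1 + d i) = d i" for i
    using le by (subst (asm) sum_nonneg_eq_0_iff) auto
  have "d i = 0" for i
    using ln_eq_minus_one[OF pos[of i]] eq[of i] by simp
  then show "Y = X" using d(4) by simp
qed

section \<open>Stationary points of the barrier problem\<close>

lemma inner_vecm: "vecm M \<bullet> vecm N = M \<bullet> N"
  by (simp add: vecm_def inner_vec_def sum.cartesian_product split_def)

lemma lin_feasible_iff: "lin_feasible A b X \<longleftrightarrow> (\<forall>l. A l \<bullet> X = b $ l)"
  by (simp add: lin_feasible_def vec_eq_iff matrix_vector_mul_component calA_def inner_vecm)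

text \<open>Differences of feasible positive definite matrices lie here. Symmetry is imposed because
  the linear constraints alone also admit non-symmetric matrices.\<close>

definition feasible_direction :: "('m::finite \<Rightarrow> real^'n^'n) \<Rightarrow> real^'n^'n \<Rightarrow> bool" where
  "feasible_direction A M \<longleftrightarrow> symmetric_mat M \<and> (\<forall>l. A l \<bullet> M = 0)"

definition barrier :: "real^'n^'n \<Rightarrow> real^'n^'n \<Rightarrow> real" where
  "barrier S X = S \<bullet> X - ln (det X)"

text \<open>The KKT conditions with the multipliers eliminated: \<open>matrix_inv X - S\<close>
  annihilates the feasible directions instead of being exhibited as a combination of the
  \<open>A l\<close>.\<close>

definition stationary ::
  "('m::finite \<Rightarrow> real^'n^'n) \<Rightarrow> real^'m \<Rightarrow> real^'n^'n \<Rightarrow> real^'n^'n \<Rightarrow> bool" where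
  "stationary A b S X \<longleftrightarrow> lin_feasible A b X \<and> pos_def X \<and>
     (\<forall>M. feasible_direction A M \<longrightarrow> matrix_inv X \<bullet> M = S \<bullet> M)"

lemma feasible_direction_diff:
  assumes "lin_feasible A b X" "lin_feasible A b Y" "symmetric_mat X" "symmetric_mat Y"
  shows "feasible_direction A (Y - X)"
  using assms by (simp add: feasible_direction_def lin_feasible_iff inner_diff_right symmetric_mat_diff)

text \<open>On Y - X the gradient X^{-1} may be replaced by S, which turns the tangent inequality
  for ln det into a comparison of barrier values.\<close>

lemma stationary_barrier_le:
  assumes X: "stationary A b S X" and Y: "lin_feasible A b Y" "pos_def Y"
  shows "barrier S X \<le> barrier S Y" and "barrier S Y \<le> barrier S X \<Longrightarrow> Y = X"
proof -
  have pX: "pos_def X" and fX: "lin_feasible A b X" using X by (auto simp: stationary_def)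
  have "feasible_direction A (Y - X)"
    using fX Y pX by (auto intro: feasible_direction_diff pos_def_symmetric)
  then have "matrix_inv X \<bullet> (Y - X) = S \<bullet> (Y - X)"
    using X by (simp add: stationary_def)
  then have eq: "matrix_inv X \<bullet> (Y - X) = S \<bullet> Y - S \<bullet> X" by (simp add: inner_diff_right)
  show "barrier S X \<le> barrier S Y"
    using logdet_gap(1)[OF pX Y(2)] eq by (simp add: barrier_def)
  show "barrier S Y \<le> barrier S X \<Longrightarrow> Y = X"
    using logdet_gap(2)[OF pX Y(2)] eq by (simp add: barrier_def)
qed

lemma minimizer_imp_stationary:
  fixes A :: "'m::finite \<Rightarrow> real^'n^'n"
  assumes fX: "lin_feasible A b X" and pX: "pos_def X"
    and min: "\<And>Y. lin_feasible A b Y \<Longrightarrow> pos_def Y \<Longrightarrow> barrier S X \<le> barrier S Y"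
  shows "stationary A b S X"
  unfolding stationary_def
proof (intro conjI allI impI fX pX)
  fix M assume M: "feasible_direction A M"
  then have "symmetric_mat M" by (simp add: feasible_direction_def)
  from pos_def_line[OF pX this] obtain d where d: "matrix_inv X \<bullet> M = (\<Sum>i\<in>UNIV. d i)"
    "\<And>e. det (X + e *\<^sub>R M) = det X * (\<Prod>i\<in>(UNIV::'n set). 1 + e * d i)"
    "\<And>e. pos_def (X + e *\<^sub>R M) \<longleftrightarrow> (\<forall>i. 1 + e * d i > 0)" by metis
  \<comment> \<open>\<open>h e\<close> is the change of the barrier from X to X + e M.\<close>
  define h where "h e = e * (S \<bullet> M) - (\<Sum>i\<in>UNIV. ln (1 + e * d i))" for e
  \<comment> \<open>For |e| < r every |e * d i| is below 1, so the segment stays in the cone; the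
    summand 1 covers d = 0 and makes the bound strict.\<close>
  define r where "r = 1 / (1 + (\<Sum>i\<in>UNIV. \<bar>d i\<bar>))"
  have s0: "(\<Sum>i\<in>UNIV. \<bar>d i\<bar>) \<ge> 0" by (intro sum_nonneg) auto
  have s1: "1 + (\<Sum>i\<in>UNIV. \<bar>d i\<bar>) > 0" using s0 by linarith
  then have r: "r > 0" by (simp add: r_def)
  have "(h has_real_derivative (1 * (S \<bullet> M) - (\<Sum>i\<in>UNIV. (1 / (1 + 0 * d i)) * (0 + 1 * d i)))) (at 0)"
    unfolding h_def by (auto intro!: derivative_eq_intros)
  then have der: "DERIV h 0 :> S \<bullet> M - (\<Sum>i\<in>UNIV. d i)" by simp
  have "h 0 \<le> h e" if "\<bar>0 - e\<bar> < r" for e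
  proof -
    have pos: "1 + e * d i > 0" for i
    proof -
      have "\<bar>d i\<bar> \<le> (\<Sum>i\<in>UNIV. \<bar>d i\<bar>)" by (intro member_le_sum) auto
      then have "\<bar>e * d i\<bar> \<le> r * (\<Sum>i\<in>UNIV. \<bar>d i\<bar>)"
        using that r unfolding abs_mult by (intro mult_mono) auto
      also have "\<dots> < 1" using s1 by (simp add: r_def divide_less_eq)
      finally show ?thesis by linarith
    qed
    have "lin_feasible A b (X + e *\<^sub>R M)"
      using M fX by (simp add: lin_feasible_iff feasible_direction_def inner_add_right)
    moreover have "pos_def (X + e *\<^sub>R M)" using d(3) pos by simp
    ultimately have "barrier S X \<le> barrier S (X + e *\<^sub>R M)" by (rule min)
    moreover have "ln (det (X + e *\<^sub>R M)) = ln (det X) + (\<Sum>i\<in>UNIV. ln (1 + e * d i))"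
    proof -
      have "ln (det X * (\<Prod>i\<in>(UNIV::'n set). 1 + e * d i))
          = ln (det X) + ln (\<Prod>i\<in>(UNIV::'n set). 1 + e * d i)"
        using pos_def_det_pos[OF pX] pos by (intro ln_mult_pos) (auto intro: prod_pos)
      also have "ln (\<Prod>i\<in>(UNIV::'n set). 1 + e * d i) = (\<Sum>i\<in>UNIV. ln (1 + e * d i))"
        using pos by (intro ln_prod) (simp_all add: less_imp_neq[symmetric])
      finally show ?thesis by (simp add: d(2))
    qed
    ultimately show ?thesis by (simp add: barrier_def h_def inner_add_right)
  qed
  then have "S \<bullet> M - (\<Sum>i\<in>UNIV. d i) = 0"
    using DERIV_local_min[OF der r] by blast
  then show "matrix_inv X \<bullet> M = S \<bullet> M" using d(1) by simp
qed

section \<open>Existence of a minimiser by compactness\<close>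

lemma pos_def_scaleR: "pos_def X \<Longrightarrow> c > 0 \<Longrightarrow> pos_def (c *\<^sub>R X)"
  by (simp add: pos_def_def symmetric_mat_scaleR scaleR_matrix_vector_assoc[symmetric])

lemma pos_def_add_pos_semidef: "pos_def X \<Longrightarrow> pos_semidef Y \<Longrightarrow> pos_def (Y + X)"
  by (simp add: pos_def_def pos_semidef_def symmetric_mat_add matrix_vector_mult_add_rdistrib
      inner_add_right add_nonneg_pos)

lemma closed_pos_semidef: "closed {Y :: real^'n^'n. pos_semidef Y}"
proof -
  have lin: "linear (\<lambda>Y :: real^'n^'n. Y *v x)" for x
    by (rule linearI) (simp_all add: matrix_vector_mult_add_rdistrib scaleR_matrix_vector_assoc)
  have "closed {Y :: real^'n^'n. transpose Y = Y \<and> (\<forall>x. 0 \<le> x \<bullet> (Y *v x))}"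
    by (intro closed_Collect_conj closed_Collect_all closed_Collect_eq closed_Collect_le
        continuous_intros linear_continuous_on linear_conv_bounded_linear[THEN iffD1] linear_transpose lin)
  then show ?thesis by (simp add: pos_semidef_def symmetric_mat_def)
qed

lemma continuous_on_det: "continuous_on T (det :: real^'n^'n \<Rightarrow> real)"
  unfolding continuous_on_def by (auto intro: tendsto_det tendsto_ident_at)

lemma trace_le_inner:
  assumes "pos_semidef (S - k *\<^sub>R mat 1)" "pos_semidef Y"
  shows "k * trace Y \<le> S \<bullet> Y"
  using pos_semidef_inner_nonneg[OF assms] by (simp add: inner_diff_left inner_mat_one)

theorem stationary_exists:
  fixes A :: "'m::finite \<Rightarrow> real^'n^'n"
  assumes S: "pos_def S" and fF: "lin_feasible A b F" and pF: "pos_def F"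
  shows "\<exists>X. stationary A b S X"
proof -
  define a where "a = barrier S F"
  \<comment> \<open>The tangent bound at 2 S^{-1} absorbs ln det Y into half of the linear term.\<close>
  define X0 where "X0 = matrix_inv ((1/2) *\<^sub>R S)"
  have pS: "pos_def ((1/2) *\<^sub>R S)" using S by (simp add: pos_def_scaleR)
  have pX0: "pos_def X0" and iX0: "matrix_inv X0 = (1/2) *\<^sub>R S"
    using pS by (simp_all add: X0_def pos_def_inv matrix_inv_matrix_inv pos_def_invertible)
  define g where "g = ln (det X0) - (1/2) * (S \<bullet> X0)"
  have ld: "ln (det Y) \<le> (1/2) * (S \<bullet> Y) + g" if "pos_def Y" for Y
    using logdet_gap(1)[OF pX0 that] by (simp add: iX0 inner_diff_right g_def right_diff_distrib)
  \<comment> \<open>A closed set containing the sublevel set at the value of F: the determinant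
    bound keeps it off the boundary of the cone, and the linear bound makes it bounded.\<close>
  define K where "K = {Y. pos_semidef Y \<and> (\<forall>l. A l \<bullet> Y = b $ l) \<and> exp (- a) \<le> det Y \<and> S \<bullet> Y \<le> 2 * (a + g)}"
  have inK: "Y \<in> K" if "lin_feasible A b Y" "pos_def Y" "barrier S Y \<le> a" for Y
  proof -
    have "S \<bullet> Y \<ge> 0"
      using pos_semidef_inner_nonneg S that(2) pos_def_imp_pos_semidef by blast
    then have "- a \<le> ln (det Y)" using that(3) by (simp add: barrier_def)
    then have "exp (- a) \<le> det Y"
      using pos_def_det_pos[OF that(2)] by (metis exp_ln exp_le_cancel_iff)
    moreover have "S \<bullet> Y \<le> 2 * (a + g)"
      using ld[OF that(2)] that(3) by (simp add: barrier_def)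
    ultimately show ?thesis
      using that by (simp add: K_def lin_feasible_iff pos_def_imp_pos_semidef)
  qed
  have KD: "lin_feasible A b Y" "pos_def Y" "det Y \<noteq> 0" if "Y \<in> K" for Y
  proof -
    show "det Y \<noteq> 0" using that exp_gt_zero[of "- a"] unfolding K_def by auto
    then show "pos_def Y" using that pos_semidef_det_pos_imp_pos_def by (auto simp: K_def)
    show "lin_feasible A b Y" using that by (simp add: K_def lin_feasible_iff)
  qed
  have "compact K"
  proof (subst compact_eq_bounded_closed, intro conjI)
    obtain k where k: "k > 0" "pos_semidef (S - k *\<^sub>R mat 1)"
      using pos_def_ge_mat_one[OF S] by blast
    have "norm Y \<le> 2 * (a + g) / k" if "Y \<in> K" for Y
    proof -
      have p: "pos_semidef Y" and s: "S \<bullet> Y \<le> 2 * (a + g)" using that by (auto simp: K_def)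
      have "k * norm Y \<le> k * trace Y"
        using pos_semidef_norm_le_trace[OF p] k by simp
      also have "\<dots> \<le> S \<bullet> Y" by (rule trace_le_inner[OF k(2) p])
      finally show ?thesis using s k(1) by (simp add: field_simps)
    qed
    then show "bounded K" by (auto simp: bounded_iff)
    show "closed K"
      unfolding K_def
      by (intro closed_Collect_conj closed_pos_semidef closed_Collect_all closed_Collect_eq
          closed_Collect_le continuous_intros continuous_on_det)
  qed
  moreover have "continuous_on K (barrier S)"
    unfolding barrier_def
    using KD(3) by (intro continuous_intros continuous_on_det) auto
  moreover have FK: "F \<in> K" using inK[OF fF pF] by (simp add: a_def)
  ultimately obtain X where X: "X \<in> K" "\<And>Y. Y \<in> K \<Longrightarrow> barrier S X \<le> barrier S Y"
    using continuous_attains_inf[of K "barrier S"] by blast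
  \<comment> \<open>Where the barrier exceeds its value at F there is nothing to compare, since F
    lies in K.\<close>
  have "barrier S X \<le> barrier S Y" if "lin_feasible A b Y" "pos_def Y" for Y
  proof (cases "barrier S Y \<le> a")
    case True
    then show ?thesis using X(2) inK that by blast
  next
    case False
    then show ?thesis using X(2)[OF FK] by (simp add: a_def)
  qed
  then have "stationary A b S X" using minimizer_imp_stationary KD[OF X(1)] by blast
  then show ?thesis ..
qed

section \<open>The central path as a family of stationary points\<close>

definition cp_slope :: "real^'n^'n \<Rightarrow> real^'n^'n \<Rightarrow> real \<Rightarrow> real^'n^'n" where
  "cp_slope C F t = t *\<^sub>R C + matrix_inv F"

lemma cp_objective_eq_barrier:
  assumes "pos_def C" "pos_def F"
  shows "cp_objective C F t X = barrier (cp_slope C F t) X"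
  using assms
  by (simp add: cp_objective_def barrier_def cp_slope_def trace_mult_eq_inner_symmetric
      pos_def_symmetric pos_def_inv_symmetric inner_add_left)

lemma cp_minimizer_iff_stationary:
  assumes "pos_def C" "pos_def F"
  shows "cp_minimizer A b C F t X \<longleftrightarrow> stationary A b (cp_slope C F t) X"
  unfolding cp_minimizer_def cp_objective_eq_barrier[OF assms]
  using minimizer_imp_stationary stationary_barrier_le(1) by (metis stationary_def)

lemma stationary_unique:
  assumes "stationary A b S X" "stationary A b S Y"
  shows "Y = X"
  using assms stationary_barrier_le[of A b S] by (metis stationary_def)

lemma cp_slope_pos_def:
  assumes "pos_def C" "pos_def F" "t \<ge> 0"
  shows "pos_def (cp_slope C F t)"
proof -
  have "pos_semidef (t *\<^sub>R C)"
    using assms pos_def_imp_pos_semidef[of C]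
    by (simp add: pos_semidef_def symmetric_mat_scaleR scaleR_matrix_vector_assoc[symmetric])
  then show ?thesis
    unfolding cp_slope_def using assms by (simp add: pos_def_add_pos_semidef pos_def_inv)
qed

text \<open>Unique existence is what gives the definite description in \<open>central_path\<close>
  its meaning.\<close>

lemma cp_minimizer_ex1:
  assumes "pos_def C" "pos_def F" "lin_feasible A b F" "t \<ge> 0"
  shows "\<exists>!X. cp_minimizer A b C F t X"
  unfolding cp_minimizer_iff_stationary[OF assms(1,2)]
  using stationary_exists[OF cp_slope_pos_def] assms stationary_unique by blast

lemma central_path_stationary:
  assumes "pos_def C" "pos_def F" "lin_feasible A b F" "t \<ge> 0"
  shows "stationary A b (cp_slope C F t) (central_path A b C F t)"
  using theI'[OF cp_minimizer_ex1[OF assms]]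
  unfolding central_path_def cp_minimizer_iff_stationary[OF assms(1,2)] .

lemma stationary_eq_central_path:
  assumes "pos_def C" "pos_def F" "lin_feasible A b F" "t \<ge> 0"
    and "stationary A b (cp_slope C F t) X"
  shows "X = central_path A b C F t"
  by (rule stationary_unique[OF central_path_stationary[OF assms(1-4)] assms(5)])

lemma central_path_0:
  assumes "pos_def C" "pos_def F" "lin_feasible A b F"
  shows "central_path A b C F 0 = F"
proof -
  have "stationary A b (cp_slope C F 0) F"
    using assms by (simp add: stationary_def cp_slope_def)
  then show ?thesis using stationary_eq_central_path[OF assms order_refl] by simp
qed

section \<open>Duality gap and convergence of the objective value\<close>

lemma inner_matrix_inv_self:
  fixes X :: "real^'n^'n"
  assumes "pos_def X"
  shows "matrix_inv X \<bullet> X = real CARD('n)"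
proof -
  have "matrix_inv X \<bullet> X = trace (matrix_inv X ** X)"
    by (simp add: trace_mult_eq_inner_symmetric pos_def_inv_symmetric assms)
  then show ?thesis by (simp add: matrix_inv_mult pos_def_invertible assms trace_I)
qed

text \<open>Test stationarity with Z - X and use X^{-1} . X = n and X^{-1} . Z >= 0. Boundary points
  Z serve the comparison with the SDP value; Z = F bounds the path itself.\<close>

lemma stationary_duality_gap:
  fixes A :: "'m::finite \<Rightarrow> real^'n^'n"
  assumes X: "stationary A b (cp_slope C F t) X"
    and Z: "lin_feasible A b Z" "pos_semidef Z"
  shows "t * (C \<bullet> X) + matrix_inv F \<bullet> X \<le> t * (C \<bullet> Z) + matrix_inv F \<bullet> Z + real CARD('n)"
proof -
  have pX: "pos_def X" and fX: "lin_feasible A b X" using X by (auto simp: stationary_def)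
  have "feasible_direction A (Z - X)"
    using fX Z pX by (auto intro: feasible_direction_diff pos_def_symmetric pos_semidef_symmetric)
  then have "matrix_inv X \<bullet> (Z - X) = cp_slope C F t \<bullet> (Z - X)"
    using X by (simp add: stationary_def)
  moreover have "matrix_inv X \<bullet> Z \<ge> 0"
    using pos_semidef_inner_nonneg[OF pos_def_imp_pos_semidef[OF pos_def_inv[OF pX]] Z(2)] .
  ultimately show ?thesis
    by (simp add: cp_slope_def inner_diff_right inner_add_left inner_matrix_inv_self[OF pX] algebra_simps)
qed

lemma trace_constraints_iff_lin_feasible:
  assumes "\<forall>l. symmetric_mat (A l)"
  shows "(\<forall>l. trace (A l ** X) = b $ l) \<longleftrightarrow> lin_feasible A b X"
  using assms by (simp add: lin_feasible_iff trace_mult_eq_inner_symmetric)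

theorem central_path_value_tendsto:
  fixes A :: "'m::finite \<Rightarrow> real^'n^'n"
  assumes symA: "\<forall>l. symmetric_mat (A l)" and C: "pos_def C" and F: "pos_def F" "lin_feasible A b F"
  shows "((\<lambda>t. trace (C ** central_path A b C F t)) \<longlongrightarrow> sdp_opt A b C) at_top"
proof -
  let ?X = "central_path A b C F"
  let ?V = "{trace (C ** X) | X. (\<forall>l. trace (A l ** X) = b $ l) \<and> pos_semidef X}"
  have tr: "trace (C ** X) = C \<bullet> X" for X
    by (simp add: trace_mult_eq_inner_symmetric pos_def_symmetric C)
  have V: "?V = {C \<bullet> X | X. lin_feasible A b X \<and> pos_semidef X}"
    unfolding trace_constraints_iff_lin_feasible[OF symA] tr ..
  have bdd: "bdd_below ?V"
    unfolding V using pos_semidef_inner_nonneg[OF pos_def_imp_pos_semidef[OF C]]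
    by (intro bdd_belowI[of _ 0]) auto
  have ne: "?V \<noteq> {}"
    unfolding V using F pos_def_imp_pos_semidef by blast
  have lower: "sdp_opt A b C \<le> C \<bullet> ?X t" if "t \<ge> 0" for t
  proof -
    have "lin_feasible A b (?X t)" "pos_semidef (?X t)"
      using central_path_stationary[OF C F that] by (auto simp: stationary_def pos_def_imp_pos_semidef)
    then show ?thesis
      unfolding sdp_opt_def by (intro cInf_lower bdd) (auto simp: V)
  qed
  show ?thesis
    unfolding tr
  proof (rule order_tendstoI)
    fix y assume "y < sdp_opt A b C"
    then show "eventually (\<lambda>t. y < C \<bullet> ?X t) at_top"
      using lower by (intro eventually_at_top_linorderI[of 0]) (metis less_le_trans)
  next
    fix y assume "sdp_opt A b C < y"
    \<comment> \<open>A near-optimal Z is enough here; no minimiser of the SDP has to be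
      produced.\<close>
    then obtain v where "v \<in> ?V" "v < y"
      unfolding sdp_opt_def using cInf_lessD[OF ne] by blast
    then obtain Z where Z: "lin_feasible A b Z" "pos_semidef Z" and y: "C \<bullet> Z < y"
      unfolding V by blast
    define c where "c = matrix_inv F \<bullet> Z + real CARD('n)"
    \<comment> \<open>Beyond this threshold the gap c / t is smaller than y - C . Z; the maximum
      with 0 makes t positive.\<close>
    have "C \<bullet> ?X t < y" if "t > max 0 (c / (y - C \<bullet> Z))" for t
    proof -
      have t: "t > 0" "c < t * (y - C \<bullet> Z)" using that y by (auto simp: divide_less_eq)
      have st: "stationary A b (cp_slope C F t) (?X t)"
        using central_path_stationary[OF C F] t by simp
      have "matrix_inv F \<bullet> ?X t \<ge> 0"
        using st by (intro pos_semidef_inner_nonneg pos_def_imp_pos_semidef pos_def_inv F) (auto simp: stationary_def)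
      then have "t * (C \<bullet> ?X t) \<le> t * (C \<bullet> Z) + c"
        using stationary_duality_gap[OF st Z] by (simp add: c_def)
      also have "\<dots> < t * y" using t(2) by (simp add: algebra_simps)
      finally show ?thesis using t(1) by simp
    qed
    then show "eventually (\<lambda>t. C \<bullet> ?X t < y) at_top"
      by (metis eventually_at_top_dense)
  qed
qed

section \<open>The second-ansatz vector field and the derivative of the central path\<close>

lemma vecm_linear: "linear vecm"
  by (rule linearI) (simp_all add: vecm_def vec_eq_iff)

text \<open>Left inverse of \<open>vecm\<close>, through which derivatives of vectorised curves are
  carried back to matrices.\<close>

definition unvecm :: "real^('n \<times> 'n) \<Rightarrow> real^'n^'n" where
  "unvecm v = (\<chi> i j. v $ (i, j))"

lemma unvecm_vecm [simp]: "unvecm (vecm M) = M"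
  by (simp add: unvecm_def vecm_def vec_eq_iff)

lemma unvecm_linear: "linear unvecm"
  by (rule linearI) (simp_all add: unvecm_def vec_eq_iff)

lemma has_vector_derivative_vecm_iff:
  "((\<lambda>s. vecm (Y s)) has_vector_derivative vecm R) F \<longleftrightarrow> (Y has_vector_derivative R) F"
proof
  assume "((\<lambda>s. vecm (Y s)) has_vector_derivative vecm R) F"
  then have "((\<lambda>s. unvecm (vecm (Y s))) has_vector_derivative unvecm (vecm R)) F"
    by (rule bounded_linear.has_vector_derivative[OF linear_conv_bounded_linear[THEN iffD1, OF unvecm_linear]])
  then show "(Y has_vector_derivative R) F" by simp
next
  assume "(Y has_vector_derivative R) F"
  then show "((\<lambda>s. vecm (Y s)) has_vector_derivative vecm R) F"
    by (rule bounded_linear.has_vector_derivative[OF linear_conv_bounded_linear[THEN iffD1, OF vecm_linear]])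
qed

lemma kron_mult_vecm: "kron P Q *v vecm M = vecm (Q ** M ** transpose P)"
proof -
  have "(kron P Q *v vecm M) $ (i, j) = (Q ** M ** transpose P) $ i $ j" for i j
  proof -
    have "(kron P Q *v vecm M) $ (i, j) = (\<Sum>k\<in>UNIV. \<Sum>l\<in>UNIV. P $ j $ l * Q $ i $ k * M $ k $ l)"
      by (simp add: kron_def vecm_def matrix_vector_mult_def sum.cartesian_product split_def)
    also have "\<dots> = (\<Sum>l\<in>UNIV. \<Sum>k\<in>UNIV. P $ j $ l * Q $ i $ k * M $ k $ l)"
      by (rule sum.swap)
    also have "\<dots> = (Q ** M ** transpose P) $ i $ j"
      by (simp add: matrix_matrix_mult_def transpose_def sum_distrib_left mult_ac)
    finally show ?thesis .
  qed
  then show ?thesis by (simp add: vec_eq_iff vecm_def)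
qed

lemma vector_mult_calA: "y v* calA A = vecm (\<Sum>l\<in>UNIV. y $ l *\<^sub>R A l)"
  by (simp add: vec_eq_iff vector_matrix_mult_def calA_def vecm_def mult.commute)

lemma calA_mult_vecm_nth: "(calA A *v vecm M) $ l = A l \<bullet> M"
  by (simp add: matrix_vector_mul_component calA_def inner_vecm)

lemma pos_def_sandwich_ge:
  fixes X :: "real^'n^'n"
  assumes "pos_def X"
  obtains k where "k > 0" "\<And>D. symmetric_mat D \<Longrightarrow> k * (D \<bullet> D) \<le> (X ** D ** X) \<bullet> D"
proof -
  obtain k where k: "k > 0" "pos_semidef (X - k *\<^sub>R mat 1)"
    using pos_def_ge_mat_one[OF assms] by blast
  show ?thesis
    by (rule that[of "k\<^sup>2"]) (use inner_sandwich_ge[OF k(2) k(2) k(1)] k(1) in auto)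
qed

text \<open>If B y = 0 and N is the combination of the \<open>A l\<close> with coefficients y, then
  0 = y . B y = (X N X) . N. Coercivity gives N = 0, and linear independence gives y = 0.\<close>

lemma normal_matrix_invertible:
  fixes A :: "'m::finite \<Rightarrow> real^'n^'n"
  assumes symA: "\<forall>l. symmetric_mat (A l)" and indep: "lin_indep_family A" and X: "pos_def X"
  shows "invertible (calA A ** kron X X ** transpose (calA A))" (is "invertible ?B")
proof -
  obtain k where k: "k > 0" "\<And>D. symmetric_mat D \<Longrightarrow> k * (D \<bullet> D) \<le> (X ** D ** X) \<bullet> D"
    using pos_def_sandwich_ge[OF X] by blast
  have tX: "transpose X = X" using X by (simp add: pos_def_def symmetric_mat_def)
  have "y = 0" if y: "?B *v y = 0" for y
  proof -
    define N where "N = (\<Sum>l\<in>UNIV. y $ l *\<^sub>R A l)"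
    have symN: "symmetric_mat N"
      unfolding N_def using symA by (intro symmetric_mat_sum symmetric_mat_scaleR) auto
    have "?B *v y = calA A *v (kron X X *v (y v* calA A))"
      by (simp flip: matrix_vector_mul_assoc)
    also have "\<dots> = calA A *v vecm (X ** N ** X)"
      by (simp add: vector_mult_calA kron_mult_vecm N_def tX)
    finally have "0 = y \<bullet> (calA A *v vecm (X ** N ** X))" using y by simp
    also have "\<dots> = (y v* calA A) \<bullet> vecm (X ** N ** X)"
      by (rule dot_lmul_matrix[symmetric])
    also have "\<dots> = (X ** N ** X) \<bullet> N"
      by (simp add: vector_mult_calA inner_vecm N_def inner_commute)
    finally have "k * (N \<bullet> N) \<le> 0" using k(2)[OF symN] by simp
    then have "N \<bullet> N \<le> 0" using k(1) by (simp add: mult_le_0_iff)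
    then have "N = 0" using inner_ge_zero[of N] inner_eq_zero_iff[of N] by linarith
    then show "y = 0" using indep by (simp add: N_def lin_indep_family_def vec_eq_iff)
  qed
  then have "\<exists>B. B ** ?B = mat 1" by (simp add: matrix_left_invertible_ker)
  then show ?thesis using invertible_left_inverse by blast
qed

text \<open>The \<open>y l\<close> are the multipliers from the normal equations. The first form
  holds at every X, since any value of the inverse yields some combination of the
  \<open>A l\<close>; tangency to the constraints needs a genuine inverse, hence the condition
  \<open>pos_def X\<close>.\<close>

lemma ansatz2_rhs_eq:
  fixes A :: "'m::finite \<Rightarrow> real^'n^'n"
  assumes symA: "\<forall>l. symmetric_mat (A l)" and indep: "lin_indep_family A"
  obtains y where "ansatz2_rhs A C X = vecm (X ** ((\<Sum>l\<in>UNIV. y l *\<^sub>R A l) - C) ** transpose X)"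
    "pos_def X \<Longrightarrow> \<forall>l. A l \<bullet> (X ** ((\<Sum>l\<in>UNIV. y l *\<^sub>R A l) - C) ** transpose X) = 0"
proof -
  let ?K = "kron X X" and ?A = "calA A"
  let ?B = "?A ** ?K ** transpose ?A"
  define z where "z = matrix_inv ?B *v (?A *v (?K *v vecm C))"
  define N where "N = (\<Sum>l\<in>UNIV. z $ l *\<^sub>R A l)"
  have KN: "?K *v (z v* ?A) = vecm (X ** N ** transpose X)"
    by (simp add: vector_mult_calA kron_mult_vecm N_def)
  have KC: "?K *v vecm C = vecm (X ** C ** transpose X)" by (rule kron_mult_vecm)
  have R: "vecm (X ** (N - C) ** transpose X) = ?K *v (z v* ?A) - ?K *v vecm C"
    unfolding KN KC by (simp add: matrix_mult_simps linear_diff[OF vecm_linear])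
  have "ansatz2_rhs A C X = - (?K *v vecm C - ?K *v (z v* ?A))"
    unfolding ansatz2_rhs_def Let_def z_def
    by (simp add: matrix_vector_mult_diff_rdistrib flip: matrix_vector_mul_assoc)
  then have 1: "ansatz2_rhs A C X = vecm (X ** (N - C) ** transpose X)" using R by simp
  have 2: "\<forall>l. A l \<bullet> (X ** (N - C) ** transpose X) = 0"
    if "pos_def X"
  proof
    fix l
    have "?A *v (?K *v (z v* ?A)) = ?B *v z" by (simp flip: matrix_vector_mul_assoc)
    also have "\<dots> = ?A *v (?K *v vecm C)"
      unfolding z_def matrix_vector_mul_assoc[of ?B] matrix_inv_mult(1)[OF normal_matrix_invertible[OF symA indep that]]
      by simp
    finally have "?A *v vecm (X ** (N - C) ** transpose X) = 0"
      unfolding R by (simp add: matrix_vector_mult_diff_distrib)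
    then show "A l \<bullet> (X ** (N - C) ** transpose X) = 0"
      by (metis calA_mult_vecm_nth zero_index)
  qed
  show ?thesis by (rule that[of "\<lambda>l. z $ l"]) (use 1 2 in \<open>simp_all add: N_def\<close>)
qed

section \<open>Difference quotients and estimates along the path\<close>

lemma has_vector_derivative_within_quotient:
  fixes f :: "real \<Rightarrow> 'b::real_normed_vector"
  shows "(f has_vector_derivative D) (at x within S) \<longleftrightarrow>
    ((\<lambda>y. (f y - f x) /\<^sub>R (y - x)) \<longlongrightarrow> D) (at x within S)"
proof -
  have "norm (f y - f x - (y - x) *\<^sub>R D) / norm (y - x) = norm ((f y - f x) /\<^sub>R (y - x) - D)"
    if "y \<noteq> x" for y
  proof -
    have "(f y - f x) /\<^sub>R (y - x) - D = (f y - f x - (y - x) *\<^sub>R D) /\<^sub>R (y - x)"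
      using that by (simp add: scaleR_diff_right)
    then show ?thesis by (simp add: divide_inverse_commute)
  qed
  then have "((\<lambda>y. norm (f y - f x - (y - x) *\<^sub>R D) / norm (y - x)) \<longlongrightarrow> 0) (at x within S) \<longleftrightarrow>
     ((\<lambda>y. norm ((f y - f x) /\<^sub>R (y - x) - D)) \<longlongrightarrow> 0) (at x within S)"
    by (intro Lim_cong_within) auto
  then show ?thesis
    unfolding has_vector_derivative_def has_derivative_iff_norm tendsto_norm_zero_iff
    using LIM_zero_iff[of "\<lambda>y. (f y - f x) /\<^sub>R (y - x)" D "at x within S"]
    by (simp add: bounded_linear_scaleR_left)
qed

lemma matrix_inv_diff:
  fixes M N :: "real^'n^'n"
  assumes "invertible M" "invertible N"
  shows "matrix_inv M - matrix_inv N = - (matrix_inv M ** (M - N) ** matrix_inv N)"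
proof -
  have "matrix_inv M ** (M - N) ** matrix_inv N
      = (matrix_inv M ** M) ** matrix_inv N - matrix_inv M ** (N ** matrix_inv N)"
    by (simp add: matrix_mult_simps matrix_mul_assoc)
  then show ?thesis by (simp add: matrix_inv_mult assms)
qed

text \<open>Divide the resolvent identity \<open>matrix_inv_diff\<close> by y - x; continuity of
  inversion supplies the limit of the remaining factor.\<close>

lemma has_vector_derivative_matrix_inv:
  fixes f :: "real \<Rightarrow> real^'n^'n"
  assumes f: "(f has_vector_derivative D) (at x within S)" and x: "x \<in> S"
    and inv: "\<And>y. y \<in> S \<Longrightarrow> invertible (f y)"
  shows "((\<lambda>y. matrix_inv (f y)) has_vector_derivative
     - (matrix_inv (f x) ** D ** matrix_inv (f x))) (at x within S)"
  unfolding has_vector_derivative_within_quotient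
proof -
  let ?q = "\<lambda>y. - (matrix_inv (f y) ** ((f y - f x) /\<^sub>R (y - x)) ** matrix_inv (f x))"
  have "(f \<longlongrightarrow> f x) (at x within S)"
    using has_vector_derivative_continuous[OF f] by (simp add: continuous_within)
  then have "((\<lambda>y. matrix_inv (f y)) \<longlongrightarrow> matrix_inv (f x)) (at x within S)"
    using inv x by (intro tendsto_matrix_inv)
  moreover have "((\<lambda>y. (f y - f x) /\<^sub>R (y - x)) \<longlongrightarrow> D) (at x within S)"
    using f by (simp add: has_vector_derivative_within_quotient)
  ultimately have "(?q \<longlongrightarrow> - (matrix_inv (f x) ** D ** matrix_inv (f x))) (at x within S)"
    by (intro tendsto_minus tendsto_matrix_mult tendsto_const)
  moreover have "eventually (\<lambda>y. ?q y = (matrix_inv (f y) - matrix_inv (f x)) /\<^sub>R (y - x)) (at x within S)"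
    unfolding eventually_at_filter
    by (intro always_eventually) (simp add: matrix_inv_diff inv x matrix_mult_simps(7,8))
  ultimately show "((\<lambda>y. (matrix_inv (f y) - matrix_inv (f x)) /\<^sub>R (y - x)) \<longlongrightarrow>
      - (matrix_inv (f x) ** D ** matrix_inv (f x))) (at x within S)"
    by (rule Lim_transform_eventually)
qed

text \<open>Cancels one power of the norm in a coercivity estimate.\<close>

lemma le_divide_of_square_le:
  fixes a c n :: real
  assumes "a * n\<^sup>2 \<le> c * n" "a > 0" "c \<ge> 0" "n \<ge> 0"
  shows "n \<le> c / a"
proof (cases "n = 0")
  case False
  then have "a * n \<le> c" using assms(1,4) by (simp add: power2_eq_square)
  then show ?thesis using assms(2) by (simp add: field_simps)
qed (use assms in simp)

text \<open>The duality gap with Z = F bounds the trace of X(s) on [0, T], and this bounds the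
  inverse from below. Continuity of the path is not yet available, so k cannot come from compactness
  of its image.\<close>

lemma central_path_inv_ge:
  fixes A :: "'m::finite \<Rightarrow> real^'n^'n"
  assumes C: "pos_def C" and F: "pos_def F" "lin_feasible A b F"
  obtains k where "k > 0"
    "\<And>s. 0 \<le> s \<Longrightarrow> s \<le> T \<Longrightarrow> pos_semidef (matrix_inv (central_path A b C F s) - k *\<^sub>R mat 1)"
proof -
  let ?X = "central_path A b C F"
  obtain e where e: "e > 0" "pos_semidef (matrix_inv F - e *\<^sub>R mat 1)"
    using pos_def_ge_mat_one[OF pos_def_inv[OF F(1)]] by blast
  have CF: "C \<bullet> F \<ge> 0"
    by (intro pos_semidef_inner_nonneg pos_def_imp_pos_semidef C F)
  \<comment> \<open>One n is the duality gap, the other is F^{-1} . F; the absolute value keeps K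
    positive for every T.\<close>
  define K where "K = (\<bar>T\<bar> * (C \<bullet> F) + 2 * real CARD('n)) / e"
  have K: "K > 0" unfolding K_def using e CF by (intro divide_pos_pos add_nonneg_pos) auto
  have "pos_semidef (matrix_inv (?X s) - (1 / K) *\<^sub>R mat 1)" if s: "0 \<le> s" "s \<le> T" for s
  proof -
    have st: "stationary A b (cp_slope C F s) (?X s)"
      by (rule central_path_stationary[OF C F s(1)])
    then have pX: "pos_def (?X s)" by (simp add: stationary_def)
    have "C \<bullet> ?X s \<ge> 0"
      by (intro pos_semidef_inner_nonneg pos_def_imp_pos_semidef C pX)
    then have "0 \<le> s * (C \<bullet> ?X s)" using s(1) by simp
    then have "matrix_inv F \<bullet> ?X s \<le> s * (C \<bullet> F) + 2 * real CARD('n)"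
      using stationary_duality_gap[OF st F(2) pos_def_imp_pos_semidef[OF F(1)]]
        inner_matrix_inv_self[OF F(1)] by simp
    also have "s * (C \<bullet> F) \<le> \<bar>T\<bar> * (C \<bullet> F)" using s CF by (intro mult_right_mono) auto
    finally have "e * trace (?X s) \<le> \<bar>T\<bar> * (C \<bullet> F) + 2 * real CARD('n)"
      using trace_le_inner[OF e(2) pos_def_imp_pos_semidef[OF pX]] by simp
    then have "trace (?X s) \<le> K" using e(1) by (simp add: K_def field_simps)
    then show ?thesis by (rule pos_def_inv_ge[OF pX])
  qed
  then show ?thesis using K by (intro that[of "1 / K"]) auto
qed

text \<open>The candidate R is prescribed by the linearised stationarity condition
  \<open>RC\<close>, so only the error of the difference quotient has to be estimated.\<close>

theorem central_path_has_vector_derivative: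
  fixes A :: "'m::finite \<Rightarrow> real^'n^'n"
  assumes C: "pos_def C" and F: "pos_def F" "lin_feasible A b F" and t: "t \<ge> 0"
    and R: "feasible_direction A R"
    and RC: "\<And>M. feasible_direction A M \<Longrightarrow>
       (matrix_inv (central_path A b C F t) ** R ** matrix_inv (central_path A b C F t)) \<bullet> M = - (C \<bullet> M)"
  shows "(central_path A b C F has_vector_derivative R) (at t within {0..})"
proof -
  define X where "X = central_path A b C F"
  define P where "P s = matrix_inv (X s)" for s
  have st: "stationary A b (cp_slope C F s) (X s)" if "s \<ge> 0" for s
    unfolding X_def by (rule central_path_stationary[OF C F that])
  have pX: "pos_def (X s)" and fX: "lin_feasible A b (X s)" if "s \<ge> 0" for s
    using st[OF that] by (auto simp: stationary_def)
  \<comment> \<open>The extra unit of time gives one k for all s near t on either side.\<close>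
  obtain k where k: "k > 0" "\<And>s. 0 \<le> s \<Longrightarrow> s \<le> t + 1 \<Longrightarrow> pos_semidef (P s - k *\<^sub>R mat 1)"
    using central_path_inv_ge[OF C F, of "t + 1"] unfolding P_def X_def by blast
  have k2: "k\<^sup>2 > 0" using k(1) by simp
  \<comment> \<open>The summand F^{-1} of the two slopes cancels, leaving only (s - t) C.\<close>
  have Pdiff: "(P s - P t) \<bullet> M = (s - t) * (C \<bullet> M)" if "s \<ge> 0" "feasible_direction A M" for s M
    using st[OF that(1)] st[OF t] that(2)
    by (simp add: stationary_def P_def cp_slope_def inner_diff_left inner_add_left algebra_simps)
  have PDP: "P s ** (X s - X t) ** P t = - (P s - P t)" if "s \<ge> 0" for s
    unfolding P_def using matrix_inv_diff[of "X s" "X t"] pX t that by (simp add: pos_def_invertible)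
  have D: "feasible_direction A (X s - X t)" if "s \<ge> 0" for s
    using pX fX that t by (auto intro!: feasible_direction_diff pos_def_symmetric)
  have sandwich: "k\<^sup>2 * (norm M)\<^sup>2 \<le> (P s ** M ** P t) \<bullet> M"
    if "0 \<le> s" "s \<le> t + 1" "symmetric_mat M" for s M
    using inner_sandwich_ge[OF k(2)[OF that(1,2)] k(2)[OF t] k(1) that(3)]
    by (simp add: power2_norm_eq_inner)
  have near: "eventually (\<lambda>s. 0 \<le> s \<and> s \<le> t + 1 \<and> s \<noteq> t) (at t within {0..})"
    unfolding eventually_at by (rule exI[of _ 1]) (auto simp: dist_real_def)
  have lip: "norm (X s - X t) \<le> norm C * \<bar>s - t\<bar> / k\<^sup>2" if s: "0 \<le> s" "s \<le> t + 1" for s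
  proof (rule le_divide_of_square_le[OF _ k2])
    let ?D = "X s - X t"
    have "k\<^sup>2 * (norm ?D)\<^sup>2 \<le> (P s ** ?D ** P t) \<bullet> ?D"
      using D[OF s(1)] by (intro sandwich s) (simp add: feasible_direction_def)
    also have "\<dots> = - ((s - t) * (C \<bullet> ?D))"
      unfolding PDP[OF s(1)] inner_minus_left Pdiff[OF s(1) D[OF s(1)]] ..
    also have "\<dots> \<le> \<bar>s - t\<bar> * \<bar>C \<bullet> ?D\<bar>" by (metis abs_ge_minus_self abs_mult)
    also have "\<dots> \<le> \<bar>s - t\<bar> * (norm C * norm ?D)"
      by (intro mult_left_mono Cauchy_Schwarz_ineq2) auto
    finally show "k\<^sup>2 * (norm ?D)\<^sup>2 \<le> norm C * \<bar>s - t\<bar> * norm ?D" by (simp add: mult_ac)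
  qed auto
  have "((\<lambda>s. norm C * \<bar>s - t\<bar> / k\<^sup>2) \<longlongrightarrow> norm C * \<bar>t - t\<bar> / k\<^sup>2) (at t within {0..})"
    using k(1) by (intro tendsto_intros) auto
  then have lim1: "((\<lambda>s. norm C * \<bar>s - t\<bar> / k\<^sup>2) \<longlongrightarrow> 0) (at t within {0..})" by simp
  have ev1: "eventually (\<lambda>s. norm (X s - X t) \<le> norm C * \<bar>s - t\<bar> / k\<^sup>2) (at t within {0..})"
    using near by eventually_elim (rule lip, auto)
  have "((\<lambda>s. X s - X t) \<longlongrightarrow> 0) (at t within {0..})"
    by (rule Lim_null_comparison[OF ev1 lim1])
  then have "(X \<longlongrightarrow> X t) (at t within {0..})" by (simp add: LIM_zero_iff)
  then have Ptend: "(P \<longlongrightarrow> P t) (at t within {0..})"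
    unfolding P_def using pX[OF t] by (intro tendsto_matrix_inv pos_def_invertible)
  define c where "c = norm R * norm (P t) / k\<^sup>2"
  \<comment> \<open>The error \<open>?G\<close> is itself a feasible direction, so the C-terms of
    the quotient and of R cancel; coercivity leaves only (P t - P s) R (P t), which tends to
    0.\<close>
  have quot: "norm ((X s - X t) /\<^sub>R (s - t) - R) \<le> norm (P t - P s) * c"
    if s: "0 \<le> s" "s \<le> t + 1" "s \<noteq> t" for s
  proof -
    let ?E = "(X s - X t) /\<^sub>R (s - t)"
    let ?G = "?E - R"
    have G: "feasible_direction A ?G"
      using D[OF s(1)] R by (simp add: feasible_direction_def inner_diff_right symmetric_mat_diff symmetric_mat_scaleR)
    have "P s ** ?E ** P t = - ((P s - P t) /\<^sub>R (s - t))"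
      by (simp only: matrix_mult_simps(7,8) PDP[OF s(1)] scaleR_minus_right)
    then have E: "(P s ** ?E ** P t) \<bullet> ?G = - (C \<bullet> ?G)"
      using Pdiff[OF s(1) G] s(3) by (simp del: scaleR_minus_right)
    have RG: "(P t ** R ** P t) \<bullet> ?G = - (C \<bullet> ?G)"
      using RC[OF G] by (simp only: P_def X_def)
    have "norm ?G \<le> norm (P t - P s) * norm R * norm (P t) / k\<^sup>2"
    proof (rule le_divide_of_square_le[OF _ k2])
      have "k\<^sup>2 * (norm ?G)\<^sup>2 \<le> (P s ** ?G ** P t) \<bullet> ?G"
        using G by (intro sandwich s) (simp add: feasible_direction_def)
      also have "\<dots> = (P s ** ?E ** P t) \<bullet> ?G - (P s ** R ** P t) \<bullet> ?G"
        by (simp only: matrix_mult_simps(3,4) inner_diff_left)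
      also have "\<dots> = (P t ** R ** P t) \<bullet> ?G - (P s ** R ** P t) \<bullet> ?G"
        by (simp only: E RG)
      also have "\<dots> = ((P t - P s) ** R ** P t) \<bullet> ?G"
        by (simp only: matrix_mult_simps(3,4) inner_diff_left)
      also have "\<dots> \<le> norm ((P t - P s) ** R ** P t) * norm ?G"
        by (rule norm_cauchy_schwarz)
      also have "\<dots> \<le> norm (P t - P s) * norm R * norm (P t) * norm ?G"
        by (intro mult_right_mono norm_matrix_mult_le[THEN order_trans]) (auto intro: norm_matrix_mult_le)
      finally show "k\<^sup>2 * (norm ?G)\<^sup>2 \<le> norm (P t - P s) * norm R * norm (P t) * norm ?G" .
    qed auto
    then show ?thesis by (simp add: c_def)
  qed
  have "((\<lambda>s. norm (P t - P s) * c) \<longlongrightarrow> norm (P t - P t) * c) (at t within {0..})"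
    by (intro tendsto_intros Ptend)
  then have lim2: "((\<lambda>s. norm (P t - P s) * c) \<longlongrightarrow> 0) (at t within {0..})" by simp
  have ev2: "eventually (\<lambda>s. norm ((X s - X t) /\<^sub>R (s - t) - R) \<le> norm (P t - P s) * c)
      (at t within {0..})"
    using near by eventually_elim (rule quot, auto)
  have "((\<lambda>s. (X s - X t) /\<^sub>R (s - t) - R) \<longlongrightarrow> 0) (at t within {0..})"
    by (rule Lim_null_comparison[OF ev2 lim2])
  then show ?thesis
    unfolding has_vector_derivative_within_quotient X_def[symmetric] by (simp add: LIM_zero_iff)
qed

section \<open>Uniqueness of the second-ansatz dynamics\<close>

lemma ansatz2_direction_inv:
  fixes X N :: "real^'n^'n"
  assumes "pos_def X"
  shows "matrix_inv X ** (X ** N ** transpose X) ** matrix_inv X = N"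
proof -
  have "transpose X = X" using assms by (simp add: pos_def_def symmetric_mat_def)
  then have "matrix_inv X ** (X ** N ** transpose X) ** matrix_inv X
      = (matrix_inv X ** X) ** N ** (X ** matrix_inv X)"
    by (simp add: matrix_mul_assoc)
  then show ?thesis by (simp add: matrix_inv_mult pos_def_invertible assms)
qed

lemma inner_span_feasible_direction:
  assumes "feasible_direction A M"
  shows "((\<Sum>l\<in>UNIV. y l *\<^sub>R A l) - C) \<bullet> M = - (C \<bullet> M)"
  using assms by (simp add: feasible_direction_def inner_diff_left inner_sum_left)

lemma symmetric_span_diff:
  assumes "\<forall>l. symmetric_mat (A l)" "symmetric_mat C"
  shows "symmetric_mat ((\<Sum>l\<in>UNIV. y l *\<^sub>R A l) - C)"
  using assms by (intro symmetric_mat_diff symmetric_mat_sum symmetric_mat_scaleR) auto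

text \<open>Symmetry of R is stated without definiteness of X because it must be available before a
  solution is known to remain in the cone.\<close>

lemma ansatz2_rhs_direction:
  fixes A :: "'m::finite \<Rightarrow> real^'n^'n"
  assumes symA: "\<forall>l. symmetric_mat (A l)" and C: "pos_def C" and indep: "lin_indep_family A"
  obtains R where "ansatz2_rhs A C X = vecm R" "symmetric_mat R"
    "pos_def X \<Longrightarrow> feasible_direction A R"
    "\<And>M. pos_def X \<Longrightarrow> feasible_direction A M \<Longrightarrow>
       (matrix_inv X ** R ** matrix_inv X) \<bullet> M = - (C \<bullet> M)"
proof -
  obtain y where y: "ansatz2_rhs A C X = vecm (X ** ((\<Sum>l\<in>UNIV. y l *\<^sub>R A l) - C) ** transpose X)"
    "pos_def X \<Longrightarrow> \<forall>l. A l \<bullet> (X ** ((\<Sum>l\<in>UNIV. y l *\<^sub>R A l) - C) ** transpose X) = 0"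
    using ansatz2_rhs_eq[OF symA indep, of C X] by blast
  define R where "R = X ** ((\<Sum>l\<in>UNIV. y l *\<^sub>R A l) - C) ** transpose X"
  have symR: "symmetric_mat R"
    unfolding R_def using symA C
    by (intro symmetric_mat_congruence symmetric_span_diff) (simp_all add: pos_def_symmetric)
  show ?thesis
  proof
    show "ansatz2_rhs A C X = vecm R" using y(1) by (simp add: R_def)
    show "symmetric_mat R" by (rule symR)
    show "feasible_direction A R" if "pos_def X"
      using y(2)[OF that] symR by (simp add: feasible_direction_def R_def)
    show "(matrix_inv X ** R ** matrix_inv X) \<bullet> M = - (C \<bullet> M)"
      if "pos_def X" "feasible_direction A M" for M
      unfolding R_def ansatz2_direction_inv[OF that(1)] by (rule inner_span_feasible_direction[OF that(2)])
  qed
qed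

lemma central_path_ansatz2_solution:
  fixes A :: "'m::finite \<Rightarrow> real^'n^'n"
  assumes symA: "\<forall>l. symmetric_mat (A l)" and C: "pos_def C" and indep: "lin_indep_family A"
    and F: "pos_def F" "lin_feasible A b F"
  shows "ansatz2_solution A C (central_path A b C F)"
  unfolding ansatz2_solution_def
proof (intro allI impI)
  fix t :: real assume t: "t \<ge> 0"
  let ?X = "central_path A b C F t"
  have pX: "pos_def ?X" using central_path_stationary[OF C F t] by (simp add: stationary_def)
  obtain R where R: "ansatz2_rhs A C ?X = vecm R" "symmetric_mat R"
    "pos_def ?X \<Longrightarrow> feasible_direction A R"
    "\<And>M. pos_def ?X \<Longrightarrow> feasible_direction A M \<Longrightarrow>
       (matrix_inv ?X ** R ** matrix_inv ?X) \<bullet> M = - (C \<bullet> M)"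
    using ansatz2_rhs_direction[OF symA C indep] by blast
  have "(central_path A b C F has_vector_derivative R) (at t within {0..})"
    by (rule central_path_has_vector_derivative[OF C F t R(3)[OF pX] R(4)[OF pX]])
  then show "((\<lambda>s. vecm (central_path A b C F s)) has_vector_derivative ansatz2_rhs A C ?X) (at t within {0..})"
    unfolding R(1) has_vector_derivative_vecm_iff .
qed

lemma has_vector_derivative_zero_unique:
  fixes f :: "real \<Rightarrow> 'b::real_normed_vector"
  assumes "convex S" "\<And>x. x \<in> S \<Longrightarrow> (f has_vector_derivative 0) (at x within S)" "x \<in> S" "y \<in> S"
  shows "f x = f y"
  using assms by (intro has_derivative_zero_unique[of S f]) (simp_all add: has_vector_derivative_def)

text \<open>Uniqueness rests on conserved quantities, not on a Lipschitz bound: their values express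
  the stationarity conditions, which have only one solution.\<close>

theorem ansatz2_solution_unique:
  fixes A :: "'m::finite \<Rightarrow> real^'n^'n"
  assumes symA: "\<forall>l. symmetric_mat (A l)" and C: "pos_def C" and indep: "lin_indep_family A"
    and Y: "ansatz2_solution A C Y" and Y0: "pos_def (Y 0)" "lin_feasible A b (Y 0)" and t: "t \<ge> 0"
  shows "Y t = central_path A b C (Y 0) t"
proof -
  define X where "X = central_path A b C (Y 0)"
  have "\<exists>R. ansatz2_rhs A C (Y s) = vecm R \<and> symmetric_mat R \<and>
    (pos_def (Y s) \<longrightarrow> feasible_direction A R \<and> (\<forall>M. feasible_direction A M \<longrightarrow>
       (matrix_inv (Y s) ** R ** matrix_inv (Y s)) \<bullet> M = - (C \<bullet> M)))" for s
    by (rule ansatz2_rhs_direction[OF symA C indep, of "Y s"]) blast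
  then obtain R where R: "\<And>s. ansatz2_rhs A C (Y s) = vecm (R s)" "\<And>s. symmetric_mat (R s)"
    "\<And>s. pos_def (Y s) \<Longrightarrow> feasible_direction A (R s)"
    "\<And>s M. pos_def (Y s) \<Longrightarrow> feasible_direction A M \<Longrightarrow>
       (matrix_inv (Y s) ** R s ** matrix_inv (Y s)) \<bullet> M = - (C \<bullet> M)"
    by metis
  have derY: "(Y has_vector_derivative R s) (at s within {0..})" if "s \<ge> 0" for s
    using Y that unfolding ansatz2_solution_def R(1) has_vector_derivative_vecm_iff by blast
  \<comment> \<open>Serves only to make X continuous at the first exit time.\<close>
  have derX: "\<exists>D. (X has_vector_derivative D) (at s within {0..})" if "s \<ge> 0" for s
  proof -
    obtain R' where R': "ansatz2_rhs A C (X s) = vecm R'"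
      using ansatz2_rhs_direction[OF symA C indep] by blast
    then show ?thesis
      using central_path_ansatz2_solution[OF symA C indep Y0] that has_vector_derivative_vecm_iff
      unfolding ansatz2_solution_def X_def[symmetric] by metis
  qed
  \<comment> \<open>The vector field is symmetric at every matrix, whatever the junk value of the inverse.\<close>
  have symY: "symmetric_mat (Y s)" if s: "s \<ge> 0" for s
  proof -
    let ?f = "\<lambda>s. Y s - transpose (Y s)"
    have der: "(?f has_vector_derivative R s - transpose (R s)) (at s within {0..})" if "s \<ge> 0" for s
      by (intro has_vector_derivative_diff derY that
          bounded_linear.has_vector_derivative[OF linear_conv_bounded_linear[THEN iffD1, OF linear_transpose]])
    have "(?f has_vector_derivative 0) (at s within {0..})" if "s \<in> {0..}" for s
      using der[of s] that R(2)[of s] by (simp add: symmetric_mat_def)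
    from has_vector_derivative_zero_unique[OF _ this, of s 0] have "?f s = ?f 0" using s by simp
    then show ?thesis using pos_def_symmetric[OF Y0(1)] by (simp add: symmetric_mat_def)
  qed
  have eqX: "Y t = X t" if t: "t \<ge> 0" and pos: "\<And>s. 0 \<le> s \<Longrightarrow> s \<le> t \<Longrightarrow> pos_def (Y s)" for t
  proof -
    have der: "(Y has_vector_derivative R s) (at s within {0..t})" if "s \<in> {0..t}" for s
      using derY[of s] that by (auto intro: has_vector_derivative_within_subset)
    have "A l \<bullet> Y t = A l \<bullet> Y 0" for l
    proof (rule has_vector_derivative_zero_unique[of "{0..t}" "\<lambda>s. A l \<bullet> Y s"])
      fix s assume s: "s \<in> {0..t}"
      have "((\<lambda>s. A l \<bullet> Y s) has_vector_derivative A l \<bullet> R s) (at s within {0..t})"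
        by (rule bounded_linear.has_vector_derivative[OF bounded_linear_inner_right der[OF s]])
      then show "((\<lambda>s. A l \<bullet> Y s) has_vector_derivative 0) (at s within {0..t})"
        using R(3)[of s] pos s by (simp add: feasible_direction_def)
    qed (use t in auto)
    then have "lin_feasible A b (Y t)" using Y0(2) by (simp add: lin_feasible_iff)
    \<comment> \<open>Along the flow the derivative of Y^{-1} pairs with M to give C . M, so
      \<open>?g\<close> is constant; its value at 0 supplies the constant part of the slope.\<close>
    moreover have "matrix_inv (Y t) \<bullet> M = cp_slope C (Y 0) t \<bullet> M" if M: "feasible_direction A M" for M
    proof -
      let ?g = "\<lambda>s. matrix_inv (Y s) \<bullet> M - s * (C \<bullet> M)"
      have "?g t = ?g 0"
      proof (rule has_vector_derivative_zero_unique[of "{0..t}" ?g])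
        fix s assume s: "s \<in> {0..t}"
        have "((\<lambda>s. matrix_inv (Y s)) has_vector_derivative
            - (matrix_inv (Y s) ** R s ** matrix_inv (Y s))) (at s within {0..t})"
          using pos by (intro has_vector_derivative_matrix_inv der s pos_def_invertible) auto
        then have "((\<lambda>s. matrix_inv (Y s) \<bullet> M) has_vector_derivative
            - (matrix_inv (Y s) ** R s ** matrix_inv (Y s)) \<bullet> M) (at s within {0..t})"
          by (rule bounded_linear.has_vector_derivative[OF bounded_linear_inner_left])
        then have "((\<lambda>s. matrix_inv (Y s) \<bullet> M) has_vector_derivative C \<bullet> M) (at s within {0..t})"
          using R(4)[of s M] pos s M by simp
        moreover have "((\<lambda>s. s * (C \<bullet> M)) has_vector_derivative 1 * (C \<bullet> M)) (at s within {0..t})"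
          by (intro has_vector_derivative_mult_left has_vector_derivative_id)
        ultimately have "(?g has_vector_derivative C \<bullet> M - 1 * (C \<bullet> M)) (at s within {0..t})"
          by (rule has_vector_derivative_diff)
        then show "(?g has_vector_derivative 0) (at s within {0..t})" by simp
      qed (use t in auto)
      then show ?thesis by (simp add: cp_slope_def inner_add_left)
    qed
    ultimately have "stationary A b (cp_slope C (Y 0) t) (Y t)"
      using pos t by (simp add: stationary_def)
    then show ?thesis unfolding X_def by (rule stationary_eq_central_path[OF C Y0 t])
  qed
  have pX: "pos_def (X s)" if "s \<ge> 0" for s
    using central_path_stationary[OF C Y0 that] by (simp add: X_def stationary_def)
  have posY: "pos_def (Y s)" if s: "s \<ge> 0" for s
  proof (rule ccontr)
    assume neg: "\<not> pos_def (Y s)"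
    define B where "B = {s. s \<ge> 0 \<and> \<not> pos_def (Y s)}"
    define u where "u = Inf B"
    have B: "B \<noteq> {}" "bdd_below B" using neg s by (auto simp: B_def intro: bdd_belowI[of _ 0])
    have u0: "u \<ge> 0" unfolding u_def by (rule cInf_greatest[OF B(1)]) (simp add: B_def)
    have below: "pos_def (Y r)" if "0 \<le> r" "r < u" for r
      using cInf_lower[OF _ B(2), of r] that by (force simp: B_def u_def)
    have contY: "(Y \<longlongrightarrow> Y u) (at u within {0..})"
      using has_vector_derivative_continuous[OF derY[OF u0]] by (simp add: continuous_within)
    \<comment> \<open>To the left of u the solution agrees with X, so by continuity Y u = X u. The
      half-open interval avoids presupposing definiteness at u.\<close>
    have "pos_def (Y u)"
    proof (cases "u = 0")
      case True
      then show ?thesis using Y0 by simp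
    next
      case False
      then have "u > 0" using u0 by simp
      have "(X \<longlongrightarrow> X u) (at u within {0..})"
        using derX[OF u0] has_vector_derivative_continuous by (auto simp: continuous_within)
      then have 1: "(X \<longlongrightarrow> X u) (at u within {0..<u})"
        by (rule tendsto_within_subset) auto
      have 2: "(Y \<longlongrightarrow> Y u) (at u within {0..<u})"
        by (rule tendsto_within_subset[OF contY]) auto
      have "X r = Y r" if "r \<in> {0..<u}" for r
        using eqX[of r] below that by auto
      then have "(X \<longlongrightarrow> X u) (at u within {0..<u}) = (Y \<longlongrightarrow> X u) (at u within {0..<u})"
        by (intro Lim_cong_within) auto
      with 1 have 3: "(Y \<longlongrightarrow> X u) (at u within {0..<u})" by simp
      have "at u within {0..<u} \<noteq> bot"
        using \<open>u > 0\<close> by (simp add: at_within_eq_bot_iff islimpt_Ico)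
      then have "Y u = X u" using 2 3 by (rule tendsto_unique)
      then show ?thesis using pX[OF u0] by simp
    qed
    \<comment> \<open>Openness keeps Y definite for a while after u, although elements of B lie
      arbitrarily close to u. Symmetry from \<open>symY\<close> makes openness applicable.\<close>
    then obtain e where e: "e > 0" "\<And>W. symmetric_mat W \<Longrightarrow> norm (W - Y u) < e \<Longrightarrow> pos_def W"
      using pos_def_open by blast
    from contY e(1) obtain d where d: "d > 0"
      "\<And>r. r \<in> {0..} \<Longrightarrow> r \<noteq> u \<Longrightarrow> dist r u < d \<Longrightarrow> dist (Y r) (Y u) < e"
      unfolding tendsto_iff eventually_at by meson
    obtain r where r: "r \<in> B" "r < u + d"
      using cInf_lessD[OF B(1), of "u + d"] d(1) by (auto simp: u_def)
    have "u \<le> r" unfolding u_def by (rule cInf_lower[OF r(1) B(2)])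
    have "pos_def (Y r)"
    proof (cases "r = u")
      case True
      then show ?thesis using \<open>pos_def (Y u)\<close> by simp
    next
      case False
      then have "dist (Y r) (Y u) < e"
        using r \<open>u \<le> r\<close> by (intro d(2)) (auto simp: B_def dist_real_def)
      then show ?thesis using r(1) by (intro e(2) symY) (auto simp: B_def dist_norm)
    qed
    then show False using r(1) by (simp add: B_def)
  qed
  show ?thesis using eqX[OF t posY] by (simp add: X_def)
qed

theorem theorem5p4:
  fixes A :: "'m::finite \<Rightarrow> real^'n^'n" and b :: "real^'m"
    and C F :: "real^'n^'n"
  assumes symA: "\<forall>l. symmetric_mat (A l)"
    and pdC: "pos_def C"
    and indep: "lin_indep_family A"
    and feasF: "lin_feasible A b F" and pdF: "pos_def F"
  shows "(\<forall>t\<ge>0. \<exists>!X. cp_minimizer A b C F t X)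
       \<and> central_path A b C F 0 = F
       \<and> ansatz2_solution A C (central_path A b C F)
       \<and> (\<forall>Y. lin_feasible A b (Y 0) \<and> pos_def (Y 0) \<and> ansatz2_solution A C Y
              \<longrightarrow> ((\<lambda>t. trace (C ** Y t)) \<longlongrightarrow> sdp_opt A b C) at_top)"
proof (intro conjI allI impI)
  show "\<exists>!X. cp_minimizer A b C F t X" if "t \<ge> 0" for t
    by (rule cp_minimizer_ex1[OF pdC pdF feasF that])
  show "central_path A b C F 0 = F"
    by (rule central_path_0[OF pdC pdF feasF])
  show "ansatz2_solution A C (central_path A b C F)"
    by (rule central_path_ansatz2_solution[OF symA pdC indep pdF feasF])
next
  fix Y :: "real \<Rightarrow> real^'n^'n"
  assume Y: "lin_feasible A b (Y 0) \<and> pos_def (Y 0) \<and> ansatz2_solution A C Y"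
  \<comment> \<open>The comparison path is anchored at \<open>Y 0\<close> rather than at F, and
    \<open>Y 0\<close> is an admissible anchor because it is feasible and positive definite.\<close>
  have "eventually (\<lambda>t. trace (C ** central_path A b C (Y 0) t) = trace (C ** Y t)) at_top"
    using ansatz2_solution_unique[OF symA pdC indep] Y
    by (intro eventually_at_top_linorderI[of 0]) auto
  with central_path_value_tendsto[OF symA pdC] Y
  show "((\<lambda>t. trace (C ** Y t)) \<longlongrightarrow> sdp_opt A b C) at_top"
    by (blast intro: Lim_transform_eventually)
qed

end
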